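(* Let $\mathfrak{g}$ be an algebra over a field $\Bbbk$ with a pair of compatible Lie brackets $[\cdot,\cdot]_1,[\cdot,\cdot]_2$, let $X=\{f_i\mid i\in I\}$ be a linear basis of $\mathfrak{g}$ indexed by a well-ordered set $I$, and let $X'=\{F_i\mid i\in I\}$, $F_i=f_i'$, be a disjoint copy of $X$. Let $L=M(X)\cup L'$, where $L'$ is the set of all words in the alphabet $X\cup X'$ of the form $$w_0u_1w_1u_2w_2\cdots u_{s-1}w_{s-1}u_sw_s,\qquad s\ge 1,$$ such that $w_i\in M(X)\setminus\{1\}$ for $i=1,\dots,s-1$; $w_0,w_s\in M(X)$; $u_i\in M(X')\setminus\{1\}$ for $i=1,\dots,s$; $\lfloor w_i\rfloor\le\lceil u_i\rceil$ for $i=1,\dots,s-1$; and either $w_s=1$ or $\lfloor w_s\rfloor\le\lceil u_s\rceil$. Then (the image of) the set $L$ forms a linear basis of the universal enveloping associative algebra $U_{\mathrm{Lie}_2}(\mathfrak{g})$.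
   Context: A pair of compatible Lie brackets on a $\Bbbk$-vector space $\mathfrak{g}$ (equivalently, $\mathfrak{g}\in\mathrm{Lie}_2$) consists of two bilinear operations $[\cdot,\cdot]_1,[\cdot,\cdot]_2$ such that $\alpha[\cdot,\cdot]_1+\beta[\cdot,\cdot]_2$ is a Lie bracket for all $\alpha,\beta\in\Bbbk$. The (operadic) universal enveloping associative algebra of $\mathfrak{g}\in\mathrm{Lie}_2$ with linear basis $X$ is the unital associative algebra with generators $X\cup X'$, where $X'=\{x'\mid x\in X\}$ is disjoint from $X$ and $x\mapsto x'$ is a bijection, and defining relations $$xy-yx+[x,y]_1=0,\qquad x'y'-y'x'+([x,y]_2)'=0,\qquad xy'-y'x+x'y-yx'+([x,y]_1)'+[x,y]_2=0$$ for all $x,y\in X$. Here elements of $\mathfrak{g}$ are written as linear combinations of $X$, and $'$ is extended linearly to a map from $\mathfrak{g}$ to the span of $X'$. It is denoted $U_{\mathrm{Lie}_2}(\mathfrak{g})$. $M(X)$ is the set consisting of the empty word $1$ and all words $f_{j_1}\cdots f_{j_n}$, $n\ge1$, with $j_1\le\dots\le j_n$; for such a nonempty word $w$, $\lfloor w\rfloor=j_n$ is its maximal index. $M(X')$ is the set consisting of the empty word $1$ and all words $F_{k_1}\cdots F_{k_m}$, $m\ge1$, with $k_m\le\dots\le k_1$; for such a nonempty word $u$, $\lceil u\rceil=k_m$ is its minimal index. *)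

theory Defs
  imports
    "HOL-Library.Poly_Mapping"
    "HOL-Algebra.Algebraic_Closure_Type"
    "Jordan_Normal_Form.Missing_VectorSpace"
begin

section \<open>Compatible Lie brackets\<close>

text \<open>
  The bracket is required to be alternating, which in characteristic 2 is stronger than
  antisymmetry.
\<close>

definition (in vector_space) lie_bracket :: "('b \<Rightarrow> 'b \<Rightarrow> 'b) \<Rightarrow> bool" where
  "lie_bracket br \<longleftrightarrow>
     (\<forall>x. Vector_Spaces.linear scale scale (\<lambda>y. br x y)) \<and>
     (\<forall>y. Vector_Spaces.linear scale scale (\<lambda>x. br x y)) \<and>
     (\<forall>x. br x x = 0) \<and>
     (\<forall>x y z. br x (br y z) + br y (br z x) + br z (br x y) = 0)"

locale lie2_algebra = vector_space scale
  for scale :: "'k::field \<Rightarrow> 'g::ab_group_add \<Rightarrow> 'g" +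
  fixes br1 br2 :: "'g \<Rightarrow> 'g \<Rightarrow> 'g"
  assumes lie_bracket_pencil:
    "\<And>\<alpha> \<beta>. lie_bracket (\<lambda>x y. scale \<alpha> (br1 x y) + scale \<beta> (br2 x y))"

definition (in vector_space) basis_family :: "'i set \<Rightarrow> ('i \<Rightarrow> 'b) \<Rightarrow> bool" where
  "basis_family I f \<longleftrightarrow> inj_on f I \<and> independent (f ` I) \<and> span (f ` I) = UNIV"


section \<open>Free associative algebras\<close>

text \<open>
  With concatenation as the (additively written) monoid operation on words, the convolution
  product on \<^typ>\<open>'a list \<Rightarrow>\<^sub>0 'k\<close> is the product of noncommutative polynomials.
\<close>

instantiation list :: (type) monoid_add
begin

definition zero_list :: "'a list" where "zero_list = []"

definition plus_list :: "'a list \<Rightarrow> 'a list \<Rightarrow> 'a list" where "plus_list = (@)"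

instance by standard (simp_all add: zero_list_def plus_list_def)

end

definition free_algebra :: "'a set \<Rightarrow> ('a list \<Rightarrow>\<^sub>0 'k::field) ring" where
  "free_algebra A =
     \<lparr>carrier = {p. Poly_Mapping.keys p \<subseteq> lists A}, monoid.mult = (*), one = 1,
      ring.zero = 0, add = (+)\<rparr>"

abbreviation word :: "'a list \<Rightarrow> 'a list \<Rightarrow>\<^sub>0 'k::field" where
  "word w \<equiv> Poly_Mapping.single w 1"

text \<open>
  The quotient of a free algebra by a two-sided ideal, with the scalar \<^term>\<open>c\<close> acting as
  multiplication by the class of the constant polynomial \<^term>\<open>Poly_Mapping.single [] c\<close>.
\<close>

definition quotient_algebra ::
    "'a set \<Rightarrow> ('a list \<Rightarrow>\<^sub>0 'k::field) set \<Rightarrow> ('k, ('a list \<Rightarrow>\<^sub>0 'k) set) module" where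
  "quotient_algebra A J =
     (let F = free_algebra A; Q = F Quot J in
      \<lparr>carrier = carrier Q, monoid.mult = (\<otimes>\<^bsub>Q\<^esub>), one = \<one>\<^bsub>Q\<^esub>,
       ring.zero = \<zero>\<^bsub>Q\<^esub>, add = (\<oplus>\<^bsub>Q\<^esub>),
       module.smult = (\<lambda>c a. (J +>\<^bsub>F\<^esub> Poly_Mapping.single [] c) \<otimes>\<^bsub>Q\<^esub> a)\<rparr>)"


section \<open>The universal enveloping algebra\<close>

text \<open>
  The letters \<open>Unprimed i\<close> and \<open>Primed i\<close> stand for \<open>f\<^sub>i\<close> and \<open>F\<^sub>i = f\<^sub>i'\<close>.
\<close>

datatype 'i letter = Unprimed (index: 'i) | Primed (index: 'i)

definition letters :: "'i set \<Rightarrow> 'i letter set" where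
  "letters I = Unprimed ` I \<union> Primed ` I"

text \<open>
  The element of the free algebra obtained by expanding \<^term>\<open>v\<close> in the basis \<^term>\<open>f\<close> and
  replacing each basis vector \<^term>\<open>f i\<close> by the letter \<^term>\<open>l i\<close>. For
  \<^term>\<open>l = Unprimed\<close> this is \<^term>\<open>v\<close> itself, and for \<^term>\<open>l = Primed\<close> it is \<open>v'\<close>.
\<close>

definition linear_form ::
    "('k::field \<Rightarrow> 'g::ab_group_add \<Rightarrow> 'g) \<Rightarrow> 'i set \<Rightarrow> ('i \<Rightarrow> 'g) \<Rightarrow> ('i \<Rightarrow> 'i letter) \<Rightarrow> 'g
      \<Rightarrow> ('i letter list \<Rightarrow>\<^sub>0 'k)" where
  "linear_form scale I f l v =
     (\<Sum>i | i \<in> I \<and> Modules.module.representation scale (f ` I) v (f i) \<noteq> 0.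
        Poly_Mapping.single [l i] (Modules.module.representation scale (f ` I) v (f i)))"

definition lie2_relators ::
    "('k::field \<Rightarrow> 'g::ab_group_add \<Rightarrow> 'g) \<Rightarrow> ('g \<Rightarrow> 'g \<Rightarrow> 'g) \<Rightarrow> ('g \<Rightarrow> 'g \<Rightarrow> 'g) \<Rightarrow>
      'i set \<Rightarrow> ('i \<Rightarrow> 'g) \<Rightarrow> ('i letter list \<Rightarrow>\<^sub>0 'k) set" where
  "lie2_relators scale br1 br2 I f =
     (let x = (\<lambda>i. word [Unprimed i]); x' = (\<lambda>i. word [Primed i]);
          lin = linear_form scale I f Unprimed; lin' = linear_form scale I f Primed in
      (\<Union>i\<in>I. \<Union>j\<in>I.
        {x i * x j - x j * x i + lin (br1 (f i) (f j)),
         x' i * x' j - x' j * x' i + lin' (br2 (f i) (f j)),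
         x i * x' j - x' j * x i + x' i * x j - x j * x' i
           + lin' (br1 (f i) (f j)) + lin (br2 (f i) (f j))}))"

definition lie2_ideal ::
    "('k::field \<Rightarrow> 'g::ab_group_add \<Rightarrow> 'g) \<Rightarrow> ('g \<Rightarrow> 'g \<Rightarrow> 'g) \<Rightarrow> ('g \<Rightarrow> 'g \<Rightarrow> 'g) \<Rightarrow>
      'i set \<Rightarrow> ('i \<Rightarrow> 'g) \<Rightarrow> ('i letter list \<Rightarrow>\<^sub>0 'k) set" where
  "lie2_ideal scale br1 br2 I f =
     Idl\<^bsub>free_algebra (letters I)\<^esub> (lie2_relators scale br1 br2 I f)"

definition U_Lie2 ::
    "('k::field \<Rightarrow> 'g::ab_group_add \<Rightarrow> 'g) \<Rightarrow> ('g \<Rightarrow> 'g \<Rightarrow> 'g) \<Rightarrow> ('g \<Rightarrow> 'g \<Rightarrow> 'g) \<Rightarrow>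
      'i set \<Rightarrow> ('i \<Rightarrow> 'g) \<Rightarrow> ('k, ('i letter list \<Rightarrow>\<^sub>0 'k) set) module" where
  "U_Lie2 scale br1 br2 I f = quotient_algebra (letters I) (lie2_ideal scale br1 br2 I f)"

definition word_image ::
    "('k::field \<Rightarrow> 'g::ab_group_add \<Rightarrow> 'g) \<Rightarrow> ('g \<Rightarrow> 'g \<Rightarrow> 'g) \<Rightarrow> ('g \<Rightarrow> 'g \<Rightarrow> 'g) \<Rightarrow>
      'i set \<Rightarrow> ('i \<Rightarrow> 'g) \<Rightarrow> 'i letter list \<Rightarrow> ('i letter list \<Rightarrow>\<^sub>0 'k) set" where
  "word_image scale br1 br2 I f w =
     lie2_ideal scale br1 br2 I f +>\<^bsub>free_algebra (letters I)\<^esub> word w"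


section \<open>The words in \<open>L\<close>\<close>

definition MX :: "'i::wellorder set \<Rightarrow> 'i letter list set" where
  "MX I = {map Unprimed js | js. set js \<subseteq> I \<and> sorted_wrt (\<le>) js}"

definition MX' :: "'i::wellorder set \<Rightarrow> 'i letter list set" where
  "MX' I = {map Primed ks | ks. set ks \<subseteq> I \<and> sorted_wrt (\<ge>) ks}"

text \<open>
  On nonempty words, \<^term>\<open>last_index\<close> is the maximal index \<open>\<lfloor>w\<rfloor>\<close> of \<^term>\<open>w \<in> MX I\<close> and
  the minimal index \<open>\<lceil>u\<rceil>\<close> of \<^term>\<open>u \<in> MX' I\<close>.
\<close>

definition last_index :: "'i letter list \<Rightarrow> 'i" where
  "last_index w = index (last w)"

definition L' :: "'i::wellorder set \<Rightarrow> 'i letter list set" where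
  "L' I = {w 0 @ concat (map (\<lambda>i. u i @ w i) [1..<Suc s]) | s w u.
     1 \<le> s \<and>
     (\<forall>i\<in>{1..<s}. w i \<in> MX I - {[]}) \<and> w 0 \<in> MX I \<and> w s \<in> MX I \<and>
     (\<forall>i\<in>{1..s}. u i \<in> MX' I - {[]}) \<and>
     (\<forall>i\<in>{1..<s}. last_index (w i) \<le> last_index (u i)) \<and>
     (w s = [] \<or> last_index (w s) \<le> last_index (u s))}"

definition L :: "'i::wellorder set \<Rightarrow> 'i letter list set" where
  "L I = MX I \<union> L' I"


section \<open>The universal enveloping algebra is a vector space\<close>

lemma ring_free_algebra: "ring (free_algebra A :: ('a list \<Rightarrow>\<^sub>0 'k::field) ring)"
proof (rule ringI)
  show "abelian_group (free_algebra A :: ('a list \<Rightarrow>\<^sub>0 'k) ring)"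
  proof (rule abelian_groupI)
    fix x y :: "'a list \<Rightarrow>\<^sub>0 'k"
    assume "x \<in> carrier (free_algebra A)" "y \<in> carrier (free_algebra A)"
    then show "x \<oplus>\<^bsub>free_algebra A\<^esub> y \<in> carrier (free_algebra A)"
      using Poly_Mapping.keys_add[of x y] by (auto simp: free_algebra_def)
  next
    fix x :: "'a list \<Rightarrow>\<^sub>0 'k"
    assume "x \<in> carrier (free_algebra A)"
    then show "\<exists>y\<in>carrier (free_algebra A). y \<oplus>\<^bsub>free_algebra A\<^esub> x = \<zero>\<^bsub>free_algebra A\<^esub>"
      by (intro bexI[of _ "- x"]) (auto simp: free_algebra_def)
  qed (auto simp: free_algebra_def algebra_simps)
next
  show "monoid (free_algebra A :: ('a list \<Rightarrow>\<^sub>0 'k) ring)"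
  proof (rule monoidI)
    fix x y :: "'a list \<Rightarrow>\<^sub>0 'k"
    assume *: "x \<in> carrier (free_algebra A)" "y \<in> carrier (free_algebra A)"
    have "Poly_Mapping.keys (x * y) \<subseteq> {a + b | a b. a \<in> Poly_Mapping.keys x \<and> b \<in> Poly_Mapping.keys y}"
      by (rule keys_mult)
    also have "\<dots> \<subseteq> lists A"
      using * by (fastforce simp: free_algebra_def plus_list_def)
    finally show "x \<otimes>\<^bsub>free_algebra A\<^esub> y \<in> carrier (free_algebra A)"
      by (simp add: free_algebra_def)
  qed (auto simp: free_algebra_def algebra_simps zero_list_def)
qed (auto simp: free_algebra_def algebra_simps)

lemma vectorspace_quotient_algebra:
  fixes J :: "('a list \<Rightarrow>\<^sub>0 'k::field) set"
  assumes "ideal J (free_algebra A)"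
  shows "vectorspace (ring_of_type_algebra :: 'k ring) (quotient_algebra A J)"
proof -
  let ?F = "free_algebra A :: ('a list \<Rightarrow>\<^sub>0 'k) ring"
  let ?C = "\<lambda>c :: 'k. Poly_Mapping.single ([] :: 'a list) c"
  interpret F: ring ?F by (rule ring_free_algebra)
  interpret J: ideal J ?F by (rule assms)
  interpret Q: ring "?F Quot J" by (rule J.quotient_is_ring)
  have C: "?C c \<in> carrier ?F" for c
    by (auto simp: free_algebra_def)
  have Cadd: "?C (a + b) = ?C a \<oplus>\<^bsub>?F\<^esub> ?C b" for a b
    by (simp add: free_algebra_def single_add)
  have Cmult: "?C (a * b) = ?C a \<otimes>\<^bsub>?F\<^esub> ?C b" for a b
    by (simp add: free_algebra_def mult_single plus_list_def)
  have C1: "?C 1 = \<one>\<^bsub>?F\<^esub>"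
    by (simp add: free_algebra_def single_one flip: zero_list_def)
  have hom: "(+>\<^bsub>?F\<^esub>) J \<in> ring_hom ?F (?F Quot J)"
    by (rule J.rcos_ring_hom)
  have cl: "J +>\<^bsub>?F\<^esub> ?C c \<in> carrier (?F Quot J)" for c
    using ring_hom_closed[OF hom C] .
  note simps = quotient_algebra_def Let_def ring_of_type_algebra_def
  have "abelian_group (quotient_algebra A J)"
  proof (rule abelian_groupI)
    fix x assume "x \<in> carrier (quotient_algebra A J)"
    then show "\<exists>y\<in>carrier (quotient_algebra A J).
        y \<oplus>\<^bsub>quotient_algebra A J\<^esub> x = \<zero>\<^bsub>quotient_algebra A J\<^esub>"
      by (auto simp: simps intro!: bexI[of _ "\<ominus>\<^bsub>?F Quot J\<^esub> x"] Q.l_neg)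
  qed (auto simp: simps Q.a_ac)
  then have "module (ring_of_type_algebra :: 'k ring) (quotient_algebra A J)"
  proof (rule moduleI[rotated])
    show "cring (ring_of_type_algebra :: 'k ring)" by (rule cring_from_type_algebra)
  qed (use cl in \<open>auto simp: simps Cadd Cmult C1 ring_hom_add[OF hom C C] ring_hom_mult[OF hom C C]
          ring_hom_one[OF hom] Q.l_distr Q.r_distr Q.m_assoc\<close>)
  then show ?thesis
    by (simp add: vectorspace_def field_from_type_algebra)
qed

lemma lie2_relators_carrier:
  fixes scale :: "'k::field \<Rightarrow> 'g::ab_group_add \<Rightarrow> 'g" and I :: "'i set"
  shows "lie2_relators scale br1 br2 I f \<subseteq> carrier (free_algebra (letters I))"
proof -
  let ?F = "free_algebra (letters I) :: ('i letter list \<Rightarrow>\<^sub>0 'k) ring"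
  interpret F: ring ?F by (rule ring_free_algebra)
  have add: "x + y \<in> carrier ?F" if "x \<in> carrier ?F" "y \<in> carrier ?F" for x y
    using F.a_closed[OF that] by (simp add: free_algebra_def)
  have uminus: "- x \<in> carrier ?F" if "x \<in> carrier ?F" for x
    using that by (simp add: free_algebra_def)
  have diff: "x - y \<in> carrier ?F" if "x \<in> carrier ?F" "y \<in> carrier ?F" for x y
    using add[OF that(1) uminus[OF that(2)]] by simp
  have mult: "x * y \<in> carrier ?F" if "x \<in> carrier ?F" "y \<in> carrier ?F" for x y
    using F.m_closed[OF that] by (simp add: free_algebra_def)
  have sum: "sum g S \<in> carrier ?F" if "\<And>i. i \<in> S \<Longrightarrow> g i \<in> carrier ?F" for g and S :: "'i set"
    using that by (induction S rule: infinite_finite_induct)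
      (auto intro!: add, auto simp: free_algebra_def)
  have lin: "linear_form scale I f Unprimed v \<in> carrier ?F"
            "linear_form scale I f Primed v \<in> carrier ?F" for v
    unfolding linear_form_def by (intro sum; auto simp: free_algebra_def letters_def)+
  have let_i: "word [Unprimed i] \<in> carrier ?F" "word [Primed i] \<in> carrier ?F" if "i \<in> I" for i
    using that by (auto simp: free_algebra_def letters_def)
  show ?thesis
    by (auto simp: lie2_relators_def Let_def intro!: add diff mult lin let_i)
qed

lemma ideal_lie2_ideal: "ideal (lie2_ideal scale br1 br2 I f) (free_algebra (letters I))"
  unfolding lie2_ideal_def
  by (rule ring.genideal_ideal[OF ring_free_algebra lie2_relators_carrier])

lemma vectorspace_U_Lie2:
  "vectorspace (ring_of_type_algebra :: 'k::field ring)
     (U_Lie2 (scale :: 'k \<Rightarrow> 'g::ab_group_add \<Rightarrow> 'g) br1 br2 I f)"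
  unfolding U_Lie2_def by (rule vectorspace_quotient_algebra[OF ideal_lie2_ideal])

end

theory Submission
  imports Defs
begin

text \<open>
  The defining relations are the coefficients in \<open>s\<close> of \<open>[x(s), y(s)] + {x, y}(s) = 0\<close>, where
  \<open>x(s) = x + s x'\<close> and \<open>{x, y} = [x, y]\<^sub>1 + s [x, y]\<^sub>2\<close>. Order words by length, then by the number
  of pairs of a primed letter preceding an unprimed one, then by the number of ascending pairs of
  indices. With respect to this order the relations, which may be seen as exchanging the indices of
  two neighbouring letters \<open>f f\<close>, \<open>F F\<close> or \<open>F f\<close> modulo lower terms, are a quadratic Groebner basis:
  the overlaps are resolved by the Jacobi identity of the pencil. Exchanging indices preserves the
  content of a word, that is, the number of primed letters and the multiset of indices in each of its
  blocks \<open>F \<dots> F f \<dots> f\<close>. Hence every set of words that contains exactly one word of each content is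
  a basis, and \<open>L\<close> is such a set: inside a block the largest indices are given to the primed letters,
  and both parts are sorted.
\<close>

section \<open>Words and their orders\<close>

text \<open>\<open>L\<close> itself is not the set of irreducible words of a quadratic rewriting
  system: for j \<le> i < k the word F_i f_j f_k is not in \<open>L\<close>, although both of its
  two-letter factors are. The rewriting therefore uses other normal words, in which indices weakly
  decrease along each block, and the basis property is carried over to \<open>L\<close>. The
  transfer works because the leading part of every relation is a word minus another word of the same
  content: modulo lower layers, words of equal content are congruent, and the sum of coefficients
  over a content is preserved. So the choice of one word per content is free, both for spanning and
  for independence.\<close>

fun prime_count :: "'i letter list \<Rightarrow> nat" where
  "prime_count [] = 0"
| "prime_count (Unprimed i # w) = prime_count w"
| "prime_count (Primed i # w) = Suc (prime_count w)"

fun unprimed_count :: "'i letter list \<Rightarrow> nat" where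
  "unprimed_count [] = 0"
| "unprimed_count (Unprimed i # w) = Suc (unprimed_count w)"
| "unprimed_count (Primed i # w) = unprimed_count w"

fun mixed_count :: "'i letter list \<Rightarrow> nat" where
  "mixed_count [] = 0"
| "mixed_count (Unprimed i # w) = mixed_count w"
| "mixed_count (Primed i # w) = unprimed_count w + mixed_count w"

definition index_mset :: "'i letter list \<Rightarrow> 'i multiset" where
  "index_mset w = mset (map index w)"

text \<open>All pairs of positions count, not only neighbouring ones, so that exchanging the indices
  of one neighbouring ascending pair lowers the number by exactly one.\<close>

fun ascents :: "'i::wellorder letter list \<Rightarrow> nat" where
  "ascents [] = 0"
| "ascents (l # w) = size (filter_mset (\<lambda>j. index l < j) (index_mset w)) + ascents w"

lemma index_mset_simps [simp]:
  "index_mset [] = {#}"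
  "index_mset (l # w) = add_mset (index l) (index_mset w)"
  "index_mset (v @ w) = index_mset v + index_mset w"
  by (simp_all add: index_mset_def)

lemma prime_count_append [simp]: "prime_count (v @ w) = prime_count v + prime_count w"
  by (induction v rule: prime_count.induct) auto

lemma unprimed_count_append [simp]: "unprimed_count (v @ w) = unprimed_count v + unprimed_count w"
  by (induction v rule: prime_count.induct) auto

lemma length_eq_counts: "length w = prime_count w + unprimed_count w"
  by (induction w rule: prime_count.induct) auto

lemma mixed_count_append [simp]:
  "mixed_count (v @ w) = mixed_count v + mixed_count w + prime_count v * unprimed_count w"
  by (induction v rule: prime_count.induct) auto

text \<open>Ascents between a word and its context depend only on the multiset of its indices, so
  they contribute equally on both sides.\<close>

lemma ascents_append_context:
  assumes "index_mset u = index_mset u'" "ascents u < ascents u'"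
  shows "ascents (a @ u @ b) < ascents (a @ u' @ b)"
proof (induction a)
  case Nil
  have "ascents (v @ b) = ascents v + (\<Sum>i\<in>#index_mset v. size (filter_mset (\<lambda>j. i < j) (index_mset b))) + ascents b"
    for v
    by (induction v) auto
  then show ?case using assms by simp
next
  case (Cons l a)
  then show ?case using assms by simp
qed

text \<open>Equal length would not suffice in the second case: the mixed pairs formed with a context
  depend on the separate numbers of primed and unprimed letters. Fixing both makes the order
  compatible with multiplication, at the price of being only partial. In \<open>word_less\<close>
  the index multiset is fixed for the same reason.\<close>

definition layer_less :: "'i letter list \<Rightarrow> 'i letter list \<Rightarrow> bool" where
  "layer_less v w \<longleftrightarrow> length v < length w \<or>
     prime_count v = prime_count w \<and> unprimed_count v = unprimed_count w \<and>
     mixed_count v < mixed_count w"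

definition word_less :: "'i::wellorder letter list \<Rightarrow> 'i letter list \<Rightarrow> bool" where
  "word_less v w \<longleftrightarrow> layer_less v w \<or>
     prime_count v = prime_count w \<and> unprimed_count v = unprimed_count w \<and>
     mixed_count v = mixed_count w \<and> index_mset v = index_mset w \<and> ascents v < ascents w"

lemma word_less_trans: "word_less u v \<Longrightarrow> word_less v w \<Longrightarrow> word_less u w"
  by (auto simp: word_less_def layer_less_def length_eq_counts)

lemma word_less_irrefl: "\<not> word_less w w"
  by (auto simp: word_less_def layer_less_def)

lemma layer_less_imp_word_less: "layer_less u v \<Longrightarrow> word_less u v"
  by (simp add: word_less_def)

lemma layer_less_context: "layer_less u v \<Longrightarrow> layer_less (a @ u @ b) (a @ v @ b)"
  by (auto simp: layer_less_def)

lemma word_less_context: "word_less u v \<Longrightarrow> word_less (a @ u @ b) (a @ v @ b)"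
  using layer_less_context[of u v a b] ascents_append_context[of u v a b]
  by (auto simp: word_less_def)

lemma wf_word_less: "wf {(u, v). word_less u v}"
  by (rule wf_subset[of "inv_image (less_than <*lex*> less_than <*lex*> less_than)
        (\<lambda>w. (length w, mixed_count w, ascents w))"])
     (auto simp: word_less_def layer_less_def length_eq_counts)

lemma wf_layer_less: "wf {(u :: 'i::wellorder letter list, v). layer_less u v}"
  by (rule wf_subset[OF wf_word_less]) (auto simp: layer_less_imp_word_less)

section \<open>Ascending pairs and normal words\<close>

text \<open>The pair f F is left out because it is no leading word of a relation; it is also the
  place where one block ends and the next begins.\<close>

fun exchangeable :: "'i letter \<Rightarrow> 'i letter \<Rightarrow> bool" where
  "exchangeable (Unprimed i) (Primed j) = False"
| "exchangeable _ _ = True"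

definition ascending :: "'i::wellorder letter \<Rightarrow> 'i letter \<Rightarrow> bool" where
  "ascending l m \<longleftrightarrow> exchangeable l m \<and> index l < index m"

fun with_index :: "'i letter \<Rightarrow> 'i letter \<Rightarrow> 'i letter" where
  "with_index (Unprimed i) m = Unprimed (index m)"
| "with_index (Primed i) m = Primed (index m)"

abbreviation exchange :: "'i letter \<Rightarrow> 'i letter \<Rightarrow> 'i letter list" where
  "exchange l m \<equiv> [with_index l m, with_index m l]"

lemma word_less_exchange: "ascending l m \<Longrightarrow> word_less (exchange l m) [l, m]"
  by (cases l; cases m)
     (auto simp: ascending_def word_less_def)

definition reducible :: "'i::wellorder letter list \<Rightarrow> bool" where
  "reducible w \<longleftrightarrow> (\<exists>a l m b. w = a @ [l, m] @ b \<and> ascending l m)"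

lemma reducible_Cons:
  "reducible (l # w) \<longleftrightarrow> reducible w \<or> (w \<noteq> [] \<and> ascending l (hd w))"
proof
  assume "reducible (l # w)"
  then obtain a k m b where "l # w = a @ [k, m] @ b" "ascending k m"
    by (auto simp: reducible_def)
  then show "reducible w \<or> (w \<noteq> [] \<and> ascending l (hd w))"
    by (cases a) (auto simp: reducible_def)
next
  assume "reducible w \<or> (w \<noteq> [] \<and> ascending l (hd w))"
  then show "reducible (l # w)"
  proof
    assume "reducible w"
    then obtain a k m b where "w = a @ [k, m] @ b" "ascending k m"
      by (auto simp: reducible_def)
    then have "l # w = (l # a) @ [k, m] @ b" by simp
    with \<open>ascending k m\<close> show ?thesis unfolding reducible_def by blast
  next
    assume *: "w \<noteq> [] \<and> ascending l (hd w)"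
    then have "l # w = [] @ [l, hd w] @ tl w" by simp
    with * show ?thesis unfolding reducible_def by blast
  qed
qed

section \<open>The block content of a word\<close>

text \<open>
  A word is cut at each place where an unprimed letter is followed by a primed one. The content
  records, for each block, the number of primed letters and the multiset of all indices.
\<close>

fun push :: "'i letter \<Rightarrow> (nat \<times> 'i multiset) list \<Rightarrow> (nat \<times> 'i multiset) list" where
  "push (Unprimed i) [] = [(0, {#i#})]"
| "push (Unprimed i) ((a, M) # C) =
     (if a = 0 then (0, add_mset i M) # C else (0, {#i#}) # (a, M) # C)"
| "push (Primed i) [] = [(1, {#i#})]"
| "push (Primed i) ((a, M) # C) = (Suc a, add_mset i M) # C"

fun content :: "'i letter list \<Rightarrow> (nat \<times> 'i multiset) list" where
  "content [] = []"
| "content (l # w) = push l (content w)"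

lemma content_append: "content v = content v' \<Longrightarrow> content (a @ v) = content (a @ v')"
  by (induction a) auto

text \<open>An exchangeable pair never straddles a block boundary, so its indices move within one
  multiset, and the kinds of the letters stay in place.\<close>

lemma content_exchange:
  assumes "exchangeable l m"
  shows "content (a @ exchange l m @ b) = content (a @ [l, m] @ b)"
  by (rule content_append, cases "content b"; cases l; cases m)
     (use assms in \<open>auto simp: add_mset_commute\<close>)

lemma content_blocks: "(a, M) \<in> set (content w) \<Longrightarrow> a \<le> size M \<and> M \<noteq> {#}"
proof (induction w arbitrary: a M)
  case (Cons l w)
  show ?case
  proof (cases "content w")
    case Nil
    then show ?thesis using Cons.prems by (cases l) auto
  next
    case (Cons p C)
    obtain b N where p: "p = (b, N)" by fastforce
    then show ?thesis using Cons Cons.prems Cons.IH[of b N] Cons.IH[of a M]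
      by (cases l) (auto split: if_splits)
  qed
qed simp

lemma content_Nil_iff [simp]: "content w = [] \<longleftrightarrow> w = []"
proof -
  have "push l C \<noteq> []" for l :: "'a letter" and C
    by (cases "(l, C)" rule: push.cases) auto
  then show ?thesis by (cases w) auto
qed

lemma length_content: "length w = sum_list (map (size \<circ> snd) (content w))"
proof (induction w)
  case (Cons l w)
  then show ?case by (cases "(l, content w)" rule: push.cases) auto
qed simp

lemma prime_count_content: "prime_count w = sum_list (map fst (content w))"
proof (induction w)
  case (Cons l w)
  then show ?case by (cases "(l, content w)" rule: push.cases) auto
qed simp

text \<open>Each of the \<open>a\<close> primed letters of a block precedes all unprimed letters of
  its own block and of the later ones; the difference of the two sums counts the latter.\<close>

fun content_mixed :: "(nat \<times> 'i multiset) list \<Rightarrow> nat" where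
  "content_mixed [] = 0"
| "content_mixed ((a, M) # C) =
     a * (sum_list (map (size \<circ> snd) ((a, M) # C)) - sum_list (map fst ((a, M) # C))) + content_mixed C"

lemma mixed_count_content: "mixed_count w = content_mixed (content w)"
proof (induction w)
  case (Cons l w)
  have "unprimed_count w = sum_list (map (size \<circ> snd) (content w)) - sum_list (map fst (content w))"
    using length_eq_counts[of w] by (simp flip: length_content prime_count_content)
  then show ?case using Cons by (cases "(l, content w)" rule: push.cases) auto
qed simp

text \<open>Length, number of primed letters and mixed count can be read off the content, so all
  words of one content lie in the same layer.\<close>

lemma layer_less_content_cong:
  assumes "content v = content w"
  shows "layer_less v u \<longleftrightarrow> layer_less w u"
  using length_content[of v] length_content[of w] prime_count_content[of v] prime_count_content[of w]
    mixed_count_content[of v] mixed_count_content[of w] length_eq_counts[of v] length_eq_counts[of w]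
    assms
  by (auto simp: layer_less_def)

lemma layer_less_content_cong_right:
  assumes "content v = content w"
  shows "layer_less u v \<longleftrightarrow> layer_less u w"
  using length_content[of v] length_content[of w] prime_count_content[of v] prime_count_content[of w]
    mixed_count_content[of v] mixed_count_content[of w] length_eq_counts[of v] length_eq_counts[of w]
    assms
  by (auto simp: layer_less_def)

text \<open>The first letter is unprimed iff the first block counts no primed letter. As blocks are
  nonempty, a singleton first multiset reveals that the letter opened the block, so
  \<open>push\<close> can be undone.\<close>

lemma content_Cons_eqE:
  assumes "content (l # v) = content (m # w)" "index l = index m"
  shows "l = m \<and> content v = content w"
proof -
  have ne: "(a, M) \<in> set (content v) \<Longrightarrow> M \<noteq> {#} \<and> a \<le> size M"
    "(a, M) \<in> set (content w) \<Longrightarrow> M \<noteq> {#} \<and> a \<le> size M" for a M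
    using content_blocks[of a M v] content_blocks[of a M w] by auto
  show ?thesis
    by (cases "(l, content v)" rule: push.cases; cases "(m, content w)" rule: push.cases)
       (use assms ne in \<open>fastforce split: if_splits\<close>)+
qed

text \<open>Inside a block all neighbours are exchangeable, so in an irreducible word the indices
  weakly decrease along the block.\<close>

lemma normal_index_max:
  assumes "\<not> reducible (l # w)"
  shows "content (l # w) = (a, M) # C \<Longrightarrow> j \<in># M \<Longrightarrow> j \<le> index l"
  using assms
proof (induction w arbitrary: l a M C j)
  case Nil
  then show ?case by (cases l) auto
next
  case (Cons m w)
  obtain b N D where D: "content (m # w) = (b, N) # D"
    by (metis content_Nil_iff list.distinct(1) list.exhaust surj_pair)
  have nr: "\<not> reducible (m # w)" "\<not> ascending l m"
    using Cons.prems(3) by (auto simp: reducible_Cons[of l])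
  have le: "k \<le> index m" if "k \<in># N" for k
    using Cons.IH[OF D that nr(1)] .
  \<comment> \<open>Before a block with a primed letter, the unprimed letter \<open>l\<close> opens
    a block of its own, where its index is the only one.\<close>
  have b: "b \<noteq> 0" if "m = Primed x" for x
    using D that by (cases "content w") auto
  show ?case
  proof (cases "exchangeable l m")
    case True
    then have "index m \<le> index l" using nr(2) by (auto simp: ascending_def)
    then show ?thesis using Cons.prems(1,2) D le
      by (cases l) (fastforce split: if_splits)+
  next
    case False
    then obtain i k where "l = Unprimed i" "m = Primed k"
      by (cases l; cases m) auto
    then show ?thesis using Cons.prems(1,2) D b[of k] by auto
  qed
qed

lemma index_hd_in_content: "content (l # w) = (a, M) # C \<Longrightarrow> index l \<in># M"
  by (cases "(l, content w)" rule: push.cases) (auto split: if_splits)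

text \<open>The index of the first letter is the maximum of the first multiset, and index and
  content determine the letter and the content of the rest.\<close>

lemma normal_eqI:
  "\<not> reducible v \<Longrightarrow> \<not> reducible w \<Longrightarrow> content v = content w \<Longrightarrow> v = w"
proof (induction v arbitrary: w)
  case Nil
  then show ?case by (metis content_Nil_iff)
next
  case (Cons l v)
  then have "content w \<noteq> []" by (metis content_Nil_iff list.distinct(1))
  then obtain m u where w: "w = m # u" by (cases w) auto
  obtain a M C where C: "content (l # v) = (a, M) # C"
    by (metis content_Nil_iff list.distinct(1) list.exhaust surj_pair)
  have C': "content (m # u) = (a, M) # C" using C Cons.prems(3) w by simp
  have "index l = index m"
    using normal_index_max[OF _ C] normal_index_max[OF _ C'] index_hd_in_content[OF C]
      index_hd_in_content[OF C'] Cons.prems(1,2) w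
    by (meson order.antisym)
  then have "l = m \<and> content v = content u"
    using content_Cons_eqE[of l v m u] C C' by simp
  moreover have "\<not> reducible v" "\<not> reducible u"
    using Cons.prems(1,2) w by (auto simp: reducible_Cons)
  ultimately show ?case using Cons.IH[of u] w by simp
qed

section \<open>The free algebra as a vector space\<close>

text \<open>Defined as multiplication by a constant polynomial to agree with the scalar action on
  \<open>quotient_algebra\<close>.\<close>

definition poly_scale :: "'k::field \<Rightarrow> ('a list \<Rightarrow>\<^sub>0 'k) \<Rightarrow> ('a list \<Rightarrow>\<^sub>0 'k)" where
  "poly_scale c p = Poly_Mapping.single [] c * p"

lemma poly_scale_eq_map: "poly_scale c p = Poly_Mapping.map ((*) c) p"
  by (simp add: poly_scale_def mult_map_scale_conv_mult zero_list_def)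

lemma lookup_poly_scale [simp]:
  "Poly_Mapping.lookup (poly_scale c p) w = c * Poly_Mapping.lookup p w"
  by (simp add: poly_scale_eq_map Poly_Mapping.map.rep_eq when_def)

interpretation poly: vector_space "poly_scale :: 'k::field \<Rightarrow> ('a list \<Rightarrow>\<^sub>0 'k) \<Rightarrow> _"
  by unfold_locales (auto intro!: poly_mapping_eqI simp: lookup_add algebra_simps)

lemma poly_scale_single [simp]: "poly_scale c (Poly_Mapping.single w d) = Poly_Mapping.single w (c * d)"
  by (simp add: poly_scale_def mult_single plus_list_def)

lemma mult_poly_scale_left: "poly_scale c p * q = poly_scale c (p * q)"
  by (simp add: poly_scale_def mult.assoc)

lemma poly_decompose: "p = (\<Sum>w\<in>Poly_Mapping.keys p. Poly_Mapping.single w (Poly_Mapping.lookup p w))"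
proof (rule poly_mapping_eqI)
  fix v
  show "Poly_Mapping.lookup p v =
      Poly_Mapping.lookup (\<Sum>w\<in>Poly_Mapping.keys p. Poly_Mapping.single w (Poly_Mapping.lookup p w)) v"
    by (cases "v \<in> Poly_Mapping.keys p")
       (auto simp: lookup_sum lookup_single when_def in_keys_iff intro: sum.neutral)
qed

text \<open>Constants are central although the product is not commutative; this is checked on
  monomials.\<close>

lemma mult_poly_scale_right: "p * poly_scale c q = poly_scale c (p * q)"
proof -
  have "p * Poly_Mapping.single [] c = poly_scale c p"
  proof -
    have "p * Poly_Mapping.single [] c =
        (\<Sum>w\<in>Poly_Mapping.keys p. Poly_Mapping.single w (Poly_Mapping.lookup p w) * Poly_Mapping.single [] c)"
      by (subst (1) poly_decompose) (simp add: sum_distrib_right)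
    also have "\<dots> = poly_scale c (\<Sum>w\<in>Poly_Mapping.keys p. Poly_Mapping.single w (Poly_Mapping.lookup p w))"
      by (simp add: poly.scale_sum_right mult_single plus_list_def mult.commute)
    also have "\<dots> = poly_scale c p" by (simp only: poly_decompose[symmetric])
    finally show ?thesis .
  qed
  then show ?thesis by (simp add: poly_scale_def flip: mult.assoc)
qed

lemma word_mult [simp]: "word v * word w = word (v @ w)"
  by (simp add: mult_single plus_list_def)

lemma word_Nil [simp]: "word [] * p = p" "p * word [] = p"
  by (simp_all add: single_one flip: zero_list_def)

text \<open>The preimage of a subspace under a linear map. Through it, a membership after
  multiplication by \<open>a\<close> and \<open>b\<close> passes from generators to their
  span.\<close>

lemma subspace_translate:
  assumes "poly.subspace W"
  shows "poly.subspace {p. a * p * b \<in> W}"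
  using assms by (auto simp: poly.subspace_def algebra_simps mult_poly_scale_left mult_poly_scale_right)

lemma poly_in_span_words: "Poly_Mapping.keys p \<subseteq> S \<Longrightarrow> p \<in> poly.span (word ` S)"
proof (subst poly_decompose, rule poly.span_sum)
  fix w assume "Poly_Mapping.keys p \<subseteq> S" "w \<in> Poly_Mapping.keys p"
  then have "poly_scale (Poly_Mapping.lookup p w) (word w) \<in> poly.span (word ` S)"
    by (intro poly.span_scale poly.span_base) auto
  then show "Poly_Mapping.single w (Poly_Mapping.lookup p w) \<in> poly.span (word ` S)" by simp
qed

lemma keys_span_words:
  assumes "p \<in> poly.span (word ` S)"
  shows "Poly_Mapping.keys p \<subseteq> S"
  using assms
proof (induction rule: poly.span_induct_alt)
  case (step c x y)
  then show ?case
    by (auto simp: in_keys_iff lookup_add lookup_single when_def split: if_splits)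
qed simp

section \<open>The relators\<close>

locale lie2_basis = lie2_algebra scale br1 br2
  for scale :: "'k::field \<Rightarrow> 'g::ab_group_add \<Rightarrow> 'g" and br1 br2 +
  fixes I :: "'i::wellorder set" and f :: "'i \<Rightarrow> 'g"
  assumes basis: "basis_family I f"
begin

lemma inj_f: "inj_on f I" and independent_f: "independent (f ` I)" and span_f: "span (f ` I) = UNIV"
  using basis by (auto simp: basis_family_def)

section \<open>Bilinearity and Jacobi identities of the two brackets\<close>

lemma lie_bracket_br: "lie_bracket br1" "lie_bracket br2" "lie_bracket (\<lambda>x y. br1 x y + br2 x y)"
  using lie_bracket_pencil[of 1 0] lie_bracket_pencil[of 0 1] lie_bracket_pencil[of 1 1] by simp_all

lemma br_linear:
  "Vector_Spaces.linear scale scale (\<lambda>y. br1 x y)" "Vector_Spaces.linear scale scale (\<lambda>x. br1 x y)"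
  "Vector_Spaces.linear scale scale (\<lambda>y. br2 x y)" "Vector_Spaces.linear scale scale (\<lambda>x. br2 x y)"
  using lie_bracket_br(1,2) by (auto simp: lie_bracket_def)

lemma br_add [simp]:
  "br1 x (y + z) = br1 x y + br1 x z" "br1 (x + y) z = br1 x z + br1 y z"
  "br2 x (y + z) = br2 x y + br2 x z" "br2 (x + y) z = br2 x z + br2 y z"
  using br_linear[THEN module_hom_iff_linear[THEN iffD2], THEN module_hom.add] by auto

lemma br_scale [simp]:
  "br1 x (scale c y) = scale c (br1 x y)" "br1 (scale c x) y = scale c (br1 x y)"
  "br2 x (scale c y) = scale c (br2 x y)" "br2 (scale c x) y = scale c (br2 x y)"
  using br_linear[THEN module_hom_iff_linear[THEN iffD2], THEN module_hom.scale] by auto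

lemma br_self [simp]: "br1 x x = 0" "br2 x x = 0"
  using lie_bracket_br(1,2) by (auto simp: lie_bracket_def)

lemma br_zero [simp]: "br1 x 0 = 0" "br1 0 x = 0" "br2 x 0 = 0" "br2 0 x = 0"
  using br_scale[where c = 0] by simp_all

lemma br_swap: "br1 x y = - br1 y x" "br2 x y = - br2 y x"
proof -
  have "br1 (x + y) (x + y) = br1 x y + br1 y x" "br2 (x + y) (x + y) = br2 x y + br2 y x"
    by (simp_all only: br_add) (simp_all add: add.commute)
  then show "br1 x y = - br1 y x" "br2 x y = - br2 y x"
    by (simp_all add: eq_neg_iff_add_eq_0)
qed

lemma jacobi:
  "br1 x (br1 y z) + br1 y (br1 z x) + br1 z (br1 x y) = 0"
  "br2 x (br2 y z) + br2 y (br2 z x) + br2 z (br2 x y) = 0"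
  using lie_bracket_br(1,2) by (auto simp: lie_bracket_def)

text \<open>The cross terms of the Jacobi identity of the sum of the brackets, after subtracting the
  identities of each bracket.\<close>

lemma mixed_jacobi:
  "(br1 x (br2 y z) + br2 x (br1 y z)) + (br1 y (br2 z x) + br2 y (br1 z x)) +
    (br1 z (br2 x y) + br2 z (br1 x y)) = 0"
proof -
  have "br1 x (br1 y z + br2 y z) + br2 x (br1 y z + br2 y z) +
      (br1 y (br1 z x + br2 z x) + br2 y (br1 z x + br2 z x)) +
      (br1 z (br1 x y + br2 x y) + br2 z (br1 x y + br2 x y)) = 0"
    using lie_bracket_br(3) unfolding lie_bracket_def by blast
  also have "br1 x (br1 y z + br2 y z) + br2 x (br1 y z + br2 y z) +
      (br1 y (br1 z x + br2 z x) + br2 y (br1 z x + br2 z x)) +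
      (br1 z (br1 x y + br2 x y) + br2 z (br1 x y + br2 x y)) =
      ((br1 x (br2 y z) + br2 x (br1 y z)) + (br1 y (br2 z x) + br2 y (br1 z x)) +
       (br1 z (br2 x y) + br2 z (br1 x y))) +
      (br1 x (br1 y z) + br1 y (br1 z x) + br1 z (br1 x y)) +
      (br2 x (br2 y z) + br2 y (br2 z x) + br2 z (br2 x y))"
    by simp
  finally show ?thesis by (simp add: jacobi)
qed

section \<open>Coordinates as linear forms in the letters\<close>

abbreviation lform :: "('i \<Rightarrow> 'i letter) \<Rightarrow> 'g \<Rightarrow> 'i letter list \<Rightarrow>\<^sub>0 'k" where
  "lform \<equiv> linear_form scale I f"

abbreviation (input) lU where "lU \<equiv> lform Unprimed"
abbreviation (input) lP where "lP \<equiv> lform Primed"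

lemma finite_coordinates: "finite {i \<in> I. representation (f ` I) v (f i) \<noteq> 0}"
proof (rule finite_imageD)
  show "finite (f ` {i \<in> I. representation (f ` I) v (f i) \<noteq> 0})"
    by (rule finite_subset[OF _ finite_representation[of "f ` I" v]]) auto
  show "inj_on f {i \<in> I. representation (f ` I) v (f i) \<noteq> 0}"
    by (rule inj_on_subset[OF inj_f]) auto
qed

text \<open>The support in \<open>linear_form\<close> depends on the vector; over a common finite
  superset the forms of several vectors can be compared term by term.\<close>

lemma linear_form_superset:
  assumes "finite S" "S \<subseteq> I" "{i \<in> I. representation (f ` I) v (f i) \<noteq> 0} \<subseteq> S"
  shows "lform l v = (\<Sum>i\<in>S. Poly_Mapping.single [l i] (representation (f ` I) v (f i)))"
  unfolding linear_form_def by (rule sum.mono_neutral_left) (use assms in auto)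

lemma lform_add: "lform l (u + v) = lform l u + lform l v"
proof -
  let ?S = "\<lambda>v. {i \<in> I. representation (f ` I) v (f i) \<noteq> 0}"
  let ?T = "?S u \<union> ?S v \<union> ?S (u + v)"
  have "finite ?T" using finite_coordinates by auto
  then have "lform l w = (\<Sum>i\<in>?T. Poly_Mapping.single [l i] (representation (f ` I) w (f i)))"
    if "w \<in> {u, v, u + v}" for w
    by (rule linear_form_superset) (use that in auto)
  then show ?thesis
    by (simp add: representation_add[OF independent_f] span_f single_add sum.distrib)
qed

lemma lform_scale: "lform l (scale c v) = poly_scale c (lform l v)"
proof -
  let ?S = "\<lambda>v. {i \<in> I. representation (f ` I) v (f i) \<noteq> 0}"
  let ?T = "?S v \<union> ?S (scale c v)"
  have "finite ?T" using finite_coordinates by auto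
  then have "lform l w = (\<Sum>i\<in>?T. Poly_Mapping.single [l i] (representation (f ` I) w (f i)))"
    if "w \<in> {v, scale c v}" for w
    by (rule linear_form_superset) (use that in auto)
  then show ?thesis
    by (simp add: representation_scale[OF independent_f] span_f poly.scale_sum_right)
qed

lemma lform_zero [simp]: "lform l 0 = 0"
  using lform_scale[of l 0 0] by simp

lemma lform_minus: "lform l (- v) = - lform l v"
  using lform_add[of l v "- v"] by (simp add: eq_neg_iff_add_eq_0 add.commute)

lemma lform_basis [simp]:
  assumes "i \<in> I"
  shows "lform l (f i) = word [l i]"
proof -
  have *: "representation (f ` I) (f i) (f j) = (if j = i then 1 else 0)" if "j \<in> I" for j
    using assms that inj_f independent_f
    by (auto simp: representation_basis inj_on_eq_iff)
  have "{j \<in> I. representation (f ` I) (f i) (f j) \<noteq> 0} = {i}"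
    using * assms by (auto split: if_splits)
  then show ?thesis using * assms by (simp add: linear_form_def)
qed

lemma keys_lform: "Poly_Mapping.keys (lform l v) \<subseteq> {[l i] | i. i \<in> I}"
proof -
  have "Poly_Mapping.keys (lform l v) \<subseteq>
      (\<Union>i\<in>{i \<in> I. representation (f ` I) v (f i) \<noteq> 0}.
        Poly_Mapping.keys (Poly_Mapping.single [l i] (representation (f ` I) v (f i))))"
    unfolding linear_form_def by (rule keys_sum)
  then show ?thesis by fastforce
qed

text \<open>Arbitrary vectors are allowed, since the syzygies contain relators with a bracket as an
  argument.\<close>

definition relator_UU :: "'g \<Rightarrow> 'g \<Rightarrow> 'i letter list \<Rightarrow>\<^sub>0 'k" where
  "relator_UU x y = lU x * lU y - lU y * lU x + lU (br1 x y)"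

definition relator_PP :: "'g \<Rightarrow> 'g \<Rightarrow> 'i letter list \<Rightarrow>\<^sub>0 'k" where
  "relator_PP x y = lP x * lP y - lP y * lP x + lP (br2 x y)"

definition relator_PU :: "'g \<Rightarrow> 'g \<Rightarrow> 'i letter list \<Rightarrow>\<^sub>0 'k" where
  "relator_PU x y = lU x * lP y - lP y * lU x + lP x * lU y - lU y * lP x
     + lP (br1 x y) + lU (br2 x y)"

lemmas relator_defs = relator_UU_def relator_PP_def relator_PU_def

lemma relators_eq:
  "lie2_relators scale br1 br2 I f =
     (\<Union>i\<in>I. \<Union>j\<in>I. {relator_UU (f i) (f j), relator_PP (f i) (f j), relator_PU (f i) (f j)})"
  by (simp add: lie2_relators_def Let_def relator_defs)

lemma relator_add_right:
  "relator_UU x (y + z) = relator_UU x y + relator_UU x z"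
  "relator_PP x (y + z) = relator_PP x y + relator_PP x z"
  "relator_PU x (y + z) = relator_PU x y + relator_PU x z"
  by (simp_all add: relator_defs lform_add algebra_simps)

lemma relator_scale_right:
  "relator_UU x (scale c y) = poly_scale c (relator_UU x y)"
  "relator_PP x (scale c y) = poly_scale c (relator_PP x y)"
  "relator_PU x (scale c y) = poly_scale c (relator_PU x y)"
  by (simp_all add: relator_defs lform_scale mult_poly_scale_left mult_poly_scale_right
      poly.scale_right_distrib poly.scale_right_diff_distrib)

lemma relator_swap:
  "relator_UU x y = - relator_UU y x" "relator_PP x y = - relator_PP y x"
  "relator_PU x y = - relator_PU y x"
  by (subst br_swap relator_defs, simp add: relator_defs br_swap[of y x] lform_minus)+

lemma relator_self [simp]: "relator_UU x x = 0" "relator_PP x x = 0" "relator_PU x x = 0"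
  by (simp_all add: relator_defs)

text \<open>
  With \<open>x(s) = x + s x'\<close> and the bracket \<open>{x, y} = [x, y]\<^sub>1 + s [x, y]\<^sub>2\<close> of the pencil, the three
  relators are the coefficients of \<open>[x(s), y(s)] + {x, y}(s)\<close>. The Jacobi identities of the
  commutator and of the pencil give one syzygy in degree 3 of \<open>s\<close>, whose four coefficients
  are the next lemmas.
\<close>

lemma syzygy_aux:
  "lform l (br1 x (br1 y z)) + lform l (br1 y (br1 z x)) + lform l (br1 z (br1 x y)) = 0"
  "lform l (br2 x (br2 y z)) + lform l (br2 y (br2 z x)) + lform l (br2 z (br2 x y)) = 0"
  "(lform l (br1 x (br2 y z)) + lform l (br2 x (br1 y z))) +
   (lform l (br1 y (br2 z x)) + lform l (br2 y (br1 z x))) +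
   (lform l (br1 z (br2 x y)) + lform l (br2 z (br1 x y))) = 0"
  by (simp_all only: jacobi mixed_jacobi lform_zero flip: lform_add)

lemma syzygy_UUU:
  "(relator_UU x y * lU z - lU z * relator_UU x y + relator_UU z (br1 x y)) +
   (relator_UU y z * lU x - lU x * relator_UU y z + relator_UU x (br1 y z)) +
   (relator_UU z x * lU y - lU y * relator_UU z x + relator_UU y (br1 z x)) = 0"
  (is "?lhs = 0")
proof -
  \<comment> \<open>The cubic terms cancel by the Jacobi identity of commutators, and the quadratic
    ones because the commutator of a form with \<open>lU (br1 x y)\<close> occurs twice with
    opposite signs.\<close>
  have "?lhs = lU (br1 x (br1 y z)) + lU (br1 y (br1 z x)) + lU (br1 z (br1 x y))"
    by (simp add: relator_defs algebra_simps)
  then show ?thesis by (simp add: syzygy_aux)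
qed

lemma syzygy_PPP:
  "(relator_PP x y * lP z - lP z * relator_PP x y + relator_PP z (br2 x y)) +
   (relator_PP y z * lP x - lP x * relator_PP y z + relator_PP x (br2 y z)) +
   (relator_PP z x * lP y - lP y * relator_PP z x + relator_PP y (br2 z x)) = 0"
  (is "?lhs = 0")
proof -
  have "?lhs = lP (br2 x (br2 y z)) + lP (br2 y (br2 z x)) + lP (br2 z (br2 x y))"
    by (simp add: relator_defs algebra_simps)
  then show ?thesis by (simp add: syzygy_aux)
qed

lemma syzygy_PUU:
  "(relator_PU x y * lU z - lU z * relator_PU x y + relator_UU x y * lP z - lP z * relator_UU x y
     + relator_PU z (br1 x y) + relator_UU z (br2 x y)) +
   (relator_PU y z * lU x - lU x * relator_PU y z + relator_UU y z * lP x - lP x * relator_UU y z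
     + relator_PU x (br1 y z) + relator_UU x (br2 y z)) +
   (relator_PU z x * lU y - lU y * relator_PU z x + relator_UU z x * lP y - lP y * relator_UU z x
     + relator_PU y (br1 z x) + relator_UU y (br2 z x)) = 0"
  (is "?lhs = 0")
proof -
  have "?lhs = (lP (br1 x (br1 y z)) + lP (br1 y (br1 z x)) + lP (br1 z (br1 x y))) +
     ((lU (br1 x (br2 y z)) + lU (br2 x (br1 y z))) +
      (lU (br1 y (br2 z x)) + lU (br2 y (br1 z x))) +
      (lU (br1 z (br2 x y)) + lU (br2 z (br1 x y))))"
    by (simp add: relator_defs algebra_simps)
  then show ?thesis by (simp only: syzygy_aux) simp
qed

lemma syzygy_PPU:
  "(relator_PP x y * lU z - lU z * relator_PP x y + relator_PU x y * lP z - lP z * relator_PU x y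
     + relator_PP z (br1 x y) + relator_PU z (br2 x y)) +
   (relator_PP y z * lU x - lU x * relator_PP y z + relator_PU y z * lP x - lP x * relator_PU y z
     + relator_PP x (br1 y z) + relator_PU x (br2 y z)) +
   (relator_PP z x * lU y - lU y * relator_PP z x + relator_PU z x * lP y - lP y * relator_PU z x
     + relator_PP y (br1 z x) + relator_PU y (br2 z x)) = 0"
  (is "?lhs = 0")
proof -
  have "?lhs = (lU (br2 x (br2 y z)) + lU (br2 y (br2 z x)) + lU (br2 z (br2 x y))) +
     ((lP (br1 x (br2 y z)) + lP (br2 x (br1 y z))) +
      (lP (br1 y (br2 z x)) + lP (br2 y (br1 z x))) +
      (lP (br1 z (br2 x y)) + lP (br2 z (br1 x y))))"
    by (simp add: relator_defs algebra_simps)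
  then show ?thesis by (simp only: syzygy_aux) simp
qed

text \<open>The mixed relator leads with x' y, so the primed letter supplies the first argument. The
  value 0 on f F lets sums and spans range over all pairs of letters.\<close>

fun relator :: "'i letter \<Rightarrow> 'i letter \<Rightarrow> 'i letter list \<Rightarrow>\<^sub>0 'k" where
  "relator (Unprimed i) (Unprimed j) = relator_UU (f i) (f j)"
| "relator (Primed i) (Primed j) = relator_PP (f i) (f j)"
| "relator (Primed i) (Unprimed j) = relator_PU (f i) (f j)"
| "relator (Unprimed i) (Primed j) = 0"

definition low :: "'i letter \<Rightarrow> 'i letter \<Rightarrow> 'i letter list \<Rightarrow>\<^sub>0 'k" where
  "low l m = relator l m - word [l, m] + word (exchange l m)"

lemma relator_eq: "relator l m = word [l, m] - word (exchange l m) + low l m"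
  by (simp add: low_def)

text \<open>The bracket terms are shorter, and the remaining words f F of the mixed relator have
  mixed count 0 where F f has 1.\<close>

lemma keys_low:
  assumes "exchangeable l m" "index l \<in> I" "index m \<in> I" "w \<in> Poly_Mapping.keys (low l m)"
  shows "layer_less w [l, m]" "w \<in> lists (letters I)"
proof -
  let ?i = "index l" and ?j = "index m"
  have short: "layer_less w [l, m] \<and> w \<in> lists (letters I)"
    if "w \<in> Poly_Mapping.keys (lform t v)" "t = Unprimed \<or> t = Primed" for t v
    using keys_lform[of t v] that by (auto simp: layer_less_def letters_def)
  have "layer_less w [l, m] \<and> w \<in> lists (letters I)"
  proof (cases "(l, m)" rule: relator.cases)
    case (1 i j)
    then have "low l m = lU (br1 (f i) (f j))"
      using assms(2,3) by (simp add: low_def relator_defs)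
    then show ?thesis using assms(4) short by metis
  next
    case (2 i j)
    then have "low l m = lP (br2 (f i) (f j))"
      using assms(2,3) by (simp add: low_def relator_defs)
    then show ?thesis using assms(4) short by metis
  next
    case (3 i j)
    then have "low l m = word [Unprimed i, Primed j] - word [Unprimed j, Primed i]
        + lP (br1 (f i) (f j)) + lU (br2 (f i) (f j))"
      using assms(2,3) by (simp add: low_def relator_defs)
    then have "Poly_Mapping.lookup (word [Unprimed i, Primed j] :: _ \<Rightarrow>\<^sub>0 'k) w \<noteq> 0 \<or>
        Poly_Mapping.lookup (word [Unprimed j, Primed i] :: _ \<Rightarrow>\<^sub>0 'k) w \<noteq> 0 \<or>
        w \<in> Poly_Mapping.keys (lP (br1 (f i) (f j))) \<or> w \<in> Poly_Mapping.keys (lU (br2 (f i) (f j)))"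
      using assms(4) by (auto simp: in_keys_iff lookup_add lookup_minus)
    then show ?thesis
    proof (elim disjE)
      assume "w \<in> Poly_Mapping.keys (lP (br1 (f i) (f j)))"
      then show ?thesis using short by blast
    next
      assume "w \<in> Poly_Mapping.keys (lU (br2 (f i) (f j)))"
      then show ?thesis using short by blast
    qed (use 3 assms(2,3) in \<open>auto simp: lookup_single when_def layer_less_def letters_def split: if_splits\<close>)
  qed (use assms(1) in auto)
  then show "layer_less w [l, m]" "w \<in> lists (letters I)" by auto
qed

end

section \<open>The diamond lemma\<close>

context lie2_basis
begin

abbreviation W :: "'i letter list set" where "W \<equiv> lists (letters I)"

lemma letters_iff: "l \<in> letters I \<longleftrightarrow> index l \<in> I"
  by (cases l) (auto simp: letters_def)

lemma letters_with_index: "m \<in> letters I \<Longrightarrow> with_index l m \<in> letters I"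
  by (cases l) (auto simp: letters_iff)

text \<open>The multiples of relators with leading word below \<open>v\<close>. An ambiguity at
  \<open>v\<close> is resolvable in the sense of Bergman when the difference of its two reductions
  lies in their span \<open>lower_span v\<close>.\<close>

definition translates :: "'i letter list \<Rightarrow> ('i letter list \<Rightarrow>\<^sub>0 'k) set" where
  "translates v = {word a * relator l m * word b | a l m b.
     ascending l m \<and> a \<in> W \<and> b \<in> W \<and> l \<in> letters I \<and> m \<in> letters I \<and>
     word_less (a @ [l, m] @ b) v}"

definition lower_span :: "'i letter list \<Rightarrow> ('i letter list \<Rightarrow>\<^sub>0 'k) set" where
  "lower_span v = poly.span (translates v)"

lemma subspace_lower_span: "poly.subspace (lower_span v)"
  by (simp add: lower_span_def)

lemmas lower_span_intros =
  poly.subspace_add[OF subspace_lower_span] poly.subspace_diff[OF subspace_lower_span]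
  poly.subspace_neg[OF subspace_lower_span]

lemma relator_exchange: "relator (with_index l m) (with_index m l) = - relator l m"
  using relator_swap[of "f (index m)" "f (index l)"]
  by (cases "(l, m)" rule: relator.cases) simp_all

lemma relator_same_index: "index l = index m \<Longrightarrow> relator l m = 0"
  by (cases "(l, m)" rule: relator.cases) auto

text \<open>Relators are antisymmetric in the two indices, so the pair may be given in either
  orientation; either of the two words can be the leading one, hence both bounds.\<close>

lemma translate_in_lower_span:
  assumes "exchangeable l m" "a \<in> W" "b \<in> W" "l \<in> letters I" "m \<in> letters I"
    and "word_less (a @ [l, m] @ b) v" "word_less (a @ exchange l m @ b) v"
  shows "word a * relator l m * word b \<in> lower_span v"
proof (cases "index l" "index m" rule: linorder_cases)
  case less
  then show ?thesis unfolding lower_span_def translates_def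
    by (intro poly.span_base) (use assms in \<open>auto simp: ascending_def\<close>)
next
  case equal
  then show ?thesis by (simp add: relator_same_index poly.subspace_0[OF subspace_lower_span])
next
  case greater
  then have "ascending (with_index l m) (with_index m l)"
    using assms(1) by (cases l; cases m) (auto simp: ascending_def)
  then have "word a * relator (with_index l m) (with_index m l) * word b \<in> lower_span v"
    unfolding lower_span_def translates_def
    by (intro poly.span_base) (use assms in \<open>fastforce simp: letters_with_index\<close>)
  then show ?thesis
    using poly.subspace_neg[OF subspace_lower_span] by (fastforce simp: relator_exchange)
qed

lemma translate_tail:
  assumes "exchangeable l m" "l \<in> letters I" "m \<in> letters I" "n \<in> letters I"
    and "word_less [l, m, n] v" "word_less (exchange l m @ [n]) v"
  shows "relator l m * word [n] \<in> lower_span v"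
  using translate_in_lower_span[of l m "[]" "[n]" v] assms by simp

lemma translate_head:
  assumes "exchangeable l m" "l \<in> letters I" "m \<in> letters I" "n \<in> letters I"
    and "word_less [n, l, m] v" "word_less (n # exchange l m) v"
  shows "word [n] * relator l m \<in> lower_span v"
  using translate_in_lower_span[of l m "[n]" "[]" v] assms by simp

text \<open>Words of two letters lie below the longer \<open>v\<close>, and linearity extends
  membership from basis vectors to brackets in the second argument.\<close>

lemma relator_vector_in_lower_span:
  assumes "i \<in> I" "length v > 2"
  shows "relator_UU (f i) x \<in> lower_span v" "relator_PP (f i) x \<in> lower_span v"
    "relator_PU (f i) x \<in> lower_span v"
proof -
  have less: "word_less [l, m] v" for l m :: "'i letter"
    using assms(2) by (simp add: word_less_def layer_less_def)
  have rel: "relator l m \<in> lower_span v"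
    if "exchangeable l m" "l \<in> letters I" "m \<in> letters I" for l m
    using translate_in_lower_span[of l m "[]" "[]" v] that less by simp
  have x: "x \<in> span (f ` I)" by (simp add: span_f)
  note sub = poly.subspace_0[OF subspace_lower_span] poly.subspace_add[OF subspace_lower_span]
    poly.subspace_scale[OF subspace_lower_span]
  have zero: "relator_UU y 0 = 0" "relator_PP y 0 = 0" "relator_PU y 0 = 0" for y
    by (simp_all add: relator_defs)
  have base: "relator_UU (f i) (f j) \<in> lower_span v" "relator_PP (f i) (f j) \<in> lower_span v"
    "relator_PU (f i) (f j) \<in> lower_span v" if "j \<in> I" for j
    using rel[of "Unprimed i" "Unprimed j"] rel[of "Primed i" "Primed j"]
      rel[of "Primed i" "Unprimed j"] assms(1) that
    by (simp_all add: letters_iff)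
  show "relator_UU (f i) x \<in> lower_span v"
    using x by (induction rule: span_induct_alt)
      (auto simp: zero relator_add_right relator_scale_right intro: sub base)
  show "relator_PP (f i) x \<in> lower_span v"
    using x by (induction rule: span_induct_alt)
      (auto simp: zero relator_add_right relator_scale_right intro: sub base)
  show "relator_PU (f i) x \<in> lower_span v"
    using x by (induction rule: span_induct_alt)
      (auto simp: zero relator_add_right relator_scale_right intro: sub base)
qed

text \<open>As f F is never ascending, the letters have the form F..F f..f: four cases, one for each
  coefficient of the syzygy. Solved for the two products that lead with \<open>[l, m, n]\<close>,
  the syzygy leaves products with fewer mixed pairs or fewer ascents, and relators of two-letter
  words.\<close>

lemma overlap:
  assumes asc: "ascending l m" "ascending m n"
    and I: "l \<in> letters I" "m \<in> letters I" "n \<in> letters I"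
  shows "relator l m * word [n] - word [l] * relator m n \<in> lower_span [l, m, n]"
proof -
  define i j k where "i = index l" and "j = index m" and "k = index n"
  have ijk: "i < j" "j < k" "i < k" "i \<in> I" "j \<in> I" "k \<in> I"
    using assms by (auto simp: i_def j_def k_def ascending_def letters_iff)
  then have nijk: "\<not> j < i" "\<not> k < j" "\<not> k < i" by auto
  note short = relator_vector_in_lower_span[of _ "[_, _, _]", simplified]
  have ts: "relator a b * word [c] \<in> lower_span v"
    if "exchangeable a b" "index a \<in> I" "index b \<in> I" "index c \<in> I"
      "word_less [a, b, c] v" "word_less (exchange a b @ [c]) v" for a b c v
    using translate_tail[of a b c v] that by (simp add: letters_iff)
  have hs: "word [c] * relator a b \<in> lower_span v"
    if "exchangeable a b" "index a \<in> I" "index b \<in> I" "index c \<in> I"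
      "word_less [c, a, b] v" "word_less (c # exchange a b) v" for a b c v
    using translate_head[of a b c v] that by (simp add: letters_iff)
  note T = lower_span_intros
  note wl = word_less_def layer_less_def
  let ?x = "f i" and ?y = "f j" and ?z = "f k"
  consider (UUU) "l = Unprimed i" "m = Unprimed j" "n = Unprimed k"
    | (PUU) "l = Primed i" "m = Unprimed j" "n = Unprimed k"
    | (PPU) "l = Primed i" "m = Primed j" "n = Unprimed k"
    | (PPP) "l = Primed i" "m = Primed j" "n = Primed k"
    using asc by (cases l; cases m; cases n) (auto simp: i_def j_def k_def ascending_def)
  then show ?thesis
  proof cases
    case UUU
    let ?v = "[Unprimed i, Unprimed j, Unprimed k]"
    have mem:
      "word [Unprimed k] * relator_UU ?x ?y \<in> lower_span ?v"
      "relator_UU ?y ?z * word [Unprimed i] \<in> lower_span ?v"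
      "relator_UU ?z ?x * word [Unprimed j] \<in> lower_span ?v"
      "word [Unprimed j] * relator_UU ?z ?x \<in> lower_span ?v"
      subgoal using hs[of "Unprimed i" "Unprimed j" "Unprimed k" ?v] ijk nijk by (simp add: wl)
      subgoal using ts[of "Unprimed j" "Unprimed k" "Unprimed i" ?v] ijk nijk by (simp add: wl)
      subgoal using ts[of "Unprimed k" "Unprimed i" "Unprimed j" ?v] ijk nijk by (simp add: wl)
      subgoal using hs[of "Unprimed k" "Unprimed i" "Unprimed j" ?v] ijk nijk by (simp add: wl)
      done
    have "relator_UU ?x ?y * word [Unprimed k] - word [Unprimed i] * relator_UU ?y ?z =
      word [Unprimed k] * relator_UU ?x ?y - relator_UU ?z (br1 ?x ?y)
      - relator_UU ?y ?z * word [Unprimed i] - relator_UU ?x (br1 ?y ?z)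
      - relator_UU ?z ?x * word [Unprimed j] + word [Unprimed j] * relator_UU ?z ?x
      - relator_UU ?y (br1 ?z ?x)"
      using syzygy_UUU[of ?x ?y ?z] ijk by (simp add: algebra_simps eq_neg_iff_add_eq_0)
    also have "\<dots> \<in> lower_span ?v"
      by (intro T mem short ijk)
    finally show ?thesis using UUU by simp
  next
    case PPP
    let ?v = "[Primed i, Primed j, Primed k]"
    have mem:
      "word [Primed k] * relator_PP ?x ?y \<in> lower_span ?v"
      "relator_PP ?y ?z * word [Primed i] \<in> lower_span ?v"
      "relator_PP ?z ?x * word [Primed j] \<in> lower_span ?v"
      "word [Primed j] * relator_PP ?z ?x \<in> lower_span ?v"
      subgoal using hs[of "Primed i" "Primed j" "Primed k" ?v] ijk nijk by (simp add: wl)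
      subgoal using ts[of "Primed j" "Primed k" "Primed i" ?v] ijk nijk by (simp add: wl)
      subgoal using ts[of "Primed k" "Primed i" "Primed j" ?v] ijk nijk by (simp add: wl)
      subgoal using hs[of "Primed k" "Primed i" "Primed j" ?v] ijk nijk by (simp add: wl)
      done
    have "relator_PP ?x ?y * word [Primed k] - word [Primed i] * relator_PP ?y ?z =
      word [Primed k] * relator_PP ?x ?y - relator_PP ?z (br2 ?x ?y)
      - relator_PP ?y ?z * word [Primed i] - relator_PP ?x (br2 ?y ?z)
      - relator_PP ?z ?x * word [Primed j] + word [Primed j] * relator_PP ?z ?x
      - relator_PP ?y (br2 ?z ?x)"
      using syzygy_PPP[of ?x ?y ?z] ijk by (simp add: algebra_simps eq_neg_iff_add_eq_0)
    also have "\<dots> \<in> lower_span ?v"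
      by (intro T mem short ijk)
    finally show ?thesis using PPP by simp
  next
    case PUU
    let ?v = "[Primed i, Unprimed j, Unprimed k]"
    \<comment> \<open>Products of shape f F f or f f F lose mixed pairs; those of shape F f f keep
      both and have fewer than the three ascents of \<open>?v\<close>.\<close>
    have mem:
      "word [Unprimed k] * relator_PU ?x ?y \<in> lower_span ?v"
      "relator_UU ?x ?y * word [Primed k] \<in> lower_span ?v"
      "word [Primed k] * relator_UU ?x ?y \<in> lower_span ?v"
      "relator_PU ?y ?z * word [Unprimed i] \<in> lower_span ?v"
      "word [Unprimed i] * relator_PU ?y ?z \<in> lower_span ?v"
      "relator_UU ?y ?z * word [Primed i] \<in> lower_span ?v"
      "relator_PU ?z ?x * word [Unprimed j] \<in> lower_span ?v"
      "word [Unprimed j] * relator_PU ?z ?x \<in> lower_span ?v"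
      "relator_UU ?z ?x * word [Primed j] \<in> lower_span ?v"
      "word [Primed j] * relator_UU ?z ?x \<in> lower_span ?v"
      subgoal using hs[of "Primed i" "Unprimed j" "Unprimed k" ?v] ijk nijk by (simp add: wl)
      subgoal using ts[of "Unprimed i" "Unprimed j" "Primed k" ?v] ijk nijk by (simp add: wl)
      subgoal using hs[of "Unprimed i" "Unprimed j" "Primed k" ?v] ijk nijk by (simp add: wl)
      subgoal using ts[of "Primed j" "Unprimed k" "Unprimed i" ?v] ijk nijk by (simp add: wl)
      subgoal using hs[of "Primed j" "Unprimed k" "Unprimed i" ?v] ijk nijk by (simp add: wl)
      subgoal using ts[of "Unprimed j" "Unprimed k" "Primed i" ?v] ijk nijk by (simp add: wl)
      subgoal using ts[of "Primed k" "Unprimed i" "Unprimed j" ?v] ijk nijk by (simp add: wl)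
      subgoal using hs[of "Primed k" "Unprimed i" "Unprimed j" ?v] ijk nijk by (simp add: wl)
      subgoal using ts[of "Unprimed k" "Unprimed i" "Primed j" ?v] ijk nijk by (simp add: wl)
      subgoal using hs[of "Unprimed k" "Unprimed i" "Primed j" ?v] ijk nijk by (simp add: wl)
      done
    have "relator_PU ?x ?y * word [Unprimed k] - word [Primed i] * relator_UU ?y ?z =
      word [Unprimed k] * relator_PU ?x ?y - relator_UU ?x ?y * word [Primed k]
      + word [Primed k] * relator_UU ?x ?y - relator_PU ?z (br1 ?x ?y) - relator_UU ?z (br2 ?x ?y)
      - relator_PU ?y ?z * word [Unprimed i] + word [Unprimed i] * relator_PU ?y ?z
      - relator_UU ?y ?z * word [Primed i]
      - relator_PU ?x (br1 ?y ?z) - relator_UU ?x (br2 ?y ?z)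
      - relator_PU ?z ?x * word [Unprimed j] + word [Unprimed j] * relator_PU ?z ?x
      - relator_UU ?z ?x * word [Primed j] + word [Primed j] * relator_UU ?z ?x
      - relator_PU ?y (br1 ?z ?x) - relator_UU ?y (br2 ?z ?x)"
      using syzygy_PUU[of ?x ?y ?z] ijk by (simp add: algebra_simps eq_neg_iff_add_eq_0)
    also have "\<dots> \<in> lower_span ?v"
      by (intro T mem short ijk)
    finally show ?thesis using PUU by simp
  next
    case PPU
    let ?v = "[Primed i, Primed j, Unprimed k]"
    have mem:
      "word [Unprimed k] * relator_PP ?x ?y \<in> lower_span ?v"
      "relator_PU ?x ?y * word [Primed k] \<in> lower_span ?v"
      "word [Primed k] * relator_PU ?x ?y \<in> lower_span ?v"
      "relator_PP ?y ?z * word [Unprimed i] \<in> lower_span ?v"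
      "word [Unprimed i] * relator_PP ?y ?z \<in> lower_span ?v"
      "relator_PU ?y ?z * word [Primed i] \<in> lower_span ?v"
      "relator_PP ?z ?x * word [Unprimed j] \<in> lower_span ?v"
      "word [Unprimed j] * relator_PP ?z ?x \<in> lower_span ?v"
      "relator_PU ?z ?x * word [Primed j] \<in> lower_span ?v"
      "word [Primed j] * relator_PU ?z ?x \<in> lower_span ?v"
      subgoal using hs[of "Primed i" "Primed j" "Unprimed k" ?v] ijk nijk by (simp add: wl)
      subgoal using ts[of "Primed i" "Unprimed j" "Primed k" ?v] ijk nijk by (simp add: wl)
      subgoal using hs[of "Primed i" "Unprimed j" "Primed k" ?v] ijk nijk by (simp add: wl)
      subgoal using ts[of "Primed j" "Primed k" "Unprimed i" ?v] ijk nijk by (simp add: wl)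
      subgoal using hs[of "Primed j" "Primed k" "Unprimed i" ?v] ijk nijk by (simp add: wl)
      subgoal using ts[of "Primed j" "Unprimed k" "Primed i" ?v] ijk nijk by (simp add: wl)
      subgoal using ts[of "Primed k" "Primed i" "Unprimed j" ?v] ijk nijk by (simp add: wl)
      subgoal using hs[of "Primed k" "Primed i" "Unprimed j" ?v] ijk nijk by (simp add: wl)
      subgoal using ts[of "Primed k" "Unprimed i" "Primed j" ?v] ijk nijk by (simp add: wl)
      subgoal using hs[of "Primed k" "Unprimed i" "Primed j" ?v] ijk nijk by (simp add: wl)
      done
    have "relator_PP ?x ?y * word [Unprimed k] - word [Primed i] * relator_PU ?y ?z =
      word [Unprimed k] * relator_PP ?x ?y - relator_PU ?x ?y * word [Primed k]
      + word [Primed k] * relator_PU ?x ?y - relator_PP ?z (br1 ?x ?y) - relator_PU ?z (br2 ?x ?y)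
      - relator_PP ?y ?z * word [Unprimed i] + word [Unprimed i] * relator_PP ?y ?z
      - relator_PU ?y ?z * word [Primed i]
      - relator_PP ?x (br1 ?y ?z) - relator_PU ?x (br2 ?y ?z)
      - relator_PP ?z ?x * word [Unprimed j] + word [Unprimed j] * relator_PP ?z ?x
      - relator_PU ?z ?x * word [Primed j] + word [Primed j] * relator_PU ?z ?x
      - relator_PP ?y (br1 ?z ?x) - relator_PU ?y (br2 ?z ?x)"
      using syzygy_PPU[of ?x ?y ?z] ijk by (simp add: algebra_simps eq_neg_iff_add_eq_0)
    also have "\<dots> \<in> lower_span ?v"
      by (intro T mem short ijk)
    finally show ?thesis using PPU by simp
  qed
qed

lemma lower_span_context:
  assumes "p \<in> lower_span u" "a \<in> W" "b \<in> W"
  shows "word a * p * word b \<in> lower_span (a @ u @ b)"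
proof -
  have "translates u \<subseteq> {p. word a * p * word b \<in> lower_span (a @ u @ b)}"
  proof
    fix q assume "q \<in> translates u"
    then obtain c l m d where q: "q = word c * relator l m * word d" "ascending l m" "c \<in> W" "d \<in> W"
      "l \<in> letters I" "m \<in> letters I" "word_less (c @ [l, m] @ d) u"
      unfolding translates_def by blast
    have "word_less ((a @ c) @ [l, m] @ (d @ b)) (a @ u @ b)"
      using word_less_context[OF q(7), of a b] by simp
    then have "word (a @ c) * relator l m * word (d @ b) \<in> translates (a @ u @ b)"
      unfolding translates_def using q assms(2,3)
      by (intro CollectI exI[of _ "a @ c"] exI[of _ l] exI[of _ m] exI[of _ "d @ b"]) auto
    moreover have "word a * q * word b = word (a @ c) * relator l m * word (d @ b)"
      unfolding q(1) by (simp add: mult.assoc flip: word_mult)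
    ultimately show "q \<in> {p. word a * p * word b \<in> lower_span (a @ u @ b)}"
      by (simp add: lower_span_def poly.span_base)
  qed
  then have "poly.span (translates u) \<subseteq> {p. word a * p * word b \<in> lower_span (a @ u @ b)}"
    by (rule poly.span_minimal) (rule subspace_translate[OF subspace_lower_span])
  then show ?thesis using assms(1) by (auto simp: lower_span_def)
qed

lemma tail_in_span:
  assumes "ascending l m" "l \<in> letters I" "m \<in> letters I"
  shows "word [l, m] - relator l m \<in> poly.span (word ` {w \<in> W. word_less w [l, m]})"
proof -
  have 1: "low l m \<in> poly.span (word ` {w \<in> W. word_less w [l, m]})"
    using assms keys_low[of l m]
    by (intro poly_in_span_words) (auto simp: ascending_def letters_iff layer_less_imp_word_less)
  have 2: "word (exchange l m) \<in> poly.span (word ` {w \<in> W. word_less w [l, m]})"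
    using assms word_less_exchange[OF assms(1)]
    by (intro poly.span_base) (auto simp: letters_with_index)
  have "word [l, m] - relator l m = word (exchange l m) - low l m"
    by (simp add: low_def)
  then show ?thesis by (simp only: poly.span_diff[OF 2 1])
qed

text \<open>With relators r, s and leading words v, w, the difference r c w - v c s equals r c (w -
  s) - (v - r) c s, and the words in w - s and v - r are smaller than w and v.\<close>

lemma disjoint:
  assumes asc: "ascending l m" "ascending n p"
    and I: "l \<in> letters I" "m \<in> letters I" "n \<in> letters I" "p \<in> letters I" "c \<in> W"
  shows "relator l m * word (c @ [n, p]) - word ([l, m] @ c) * relator n p
    \<in> lower_span ([l, m] @ c @ [n, p])"
proof -
  let ?v = "[l, m] @ c @ [n, p]"
  let ?r = "word [l, m] - relator l m" and ?s = "word [n, p] - relator n p"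
  have 1: "word [] * ?r * (word c * relator n p) \<in> lower_span ?v"
  proof -
    have "word ` {w \<in> W. word_less w [l, m]} \<subseteq> {q. word [] * q * (word c * relator n p) \<in> lower_span ?v}"
    proof (rule image_subsetI)
      fix w assume "w \<in> {w \<in> W. word_less w [l, m]}"
      then have w: "w \<in> W" "word_less w [l, m]" by simp_all
      have "word_less ((w @ c) @ [n, p] @ []) ?v"
        using word_less_context[OF w(2), of "[]" "c @ [n, p]"] by simp
      then have "word (w @ c) * relator n p * word [] \<in> translates ?v"
        unfolding translates_def using w(1) I asc
        by (intro CollectI exI[of _ "w @ c"] exI[of _ n] exI[of _ p] exI[of _ "[]"]) auto
      then show "word w \<in> {q. word [] * q * (word c * relator n p) \<in> lower_span ?v}"
        by (simp add: lower_span_def poly.span_base flip: mult.assoc)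
    qed
    from poly.span_minimal[OF this subspace_translate[OF subspace_lower_span]] tail_in_span[OF asc(1)] I
    show "word [] * ?r * (word c * relator n p) \<in> lower_span ?v" by blast
  qed
  have 2: "(relator l m * word c) * ?s * word [] \<in> lower_span ?v"
  proof -
    have "word ` {w \<in> W. word_less w [n, p]} \<subseteq> {q. (relator l m * word c) * q * word [] \<in> lower_span ?v}"
    proof (rule image_subsetI)
      fix w assume "w \<in> {w \<in> W. word_less w [n, p]}"
      then have w: "w \<in> W" "word_less w [n, p]" by simp_all
      have "word_less ([] @ [l, m] @ (c @ w)) ?v"
        using word_less_context[OF w(2), of "[l, m] @ c" "[]"] by simp
      then have "word [] * relator l m * word (c @ w) \<in> translates ?v"
        unfolding translates_def using w(1) I asc
        by (intro CollectI exI[of _ "[]"] exI[of _ l] exI[of _ m] exI[of _ "c @ w"]) auto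
      then show "word w \<in> {q. (relator l m * word c) * q * word [] \<in> lower_span ?v}"
        by (simp add: lower_span_def poly.span_base mult.assoc)
    qed
    from poly.span_minimal[OF this subspace_translate[OF subspace_lower_span]] tail_in_span[OF asc(2)] I
    show "(relator l m * word c) * ?s * word [] \<in> lower_span ?v" by blast
  qed
  have "relator l m * word (c @ [n, p]) - word ([l, m] @ c) * relator n p =
     relator l m * (word c * word [n, p]) - word [l, m] * (word c * relator n p)"
    by (simp only: word_mult[symmetric] mult.assoc)
  also have "\<dots> = (relator l m * word c) * ?s * word [] - word [] * ?r * (word c * relator n p)"
    by (simp only: word_Nil left_diff_distrib right_diff_distrib mult.assoc) simp
  finally show ?thesis using 1 2 by (simp only: lower_span_intros)
qed

lemma confluence:
  assumes eq: "a @ [l, m] @ b = a' @ [l', m'] @ b'"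
    and asc: "ascending l m" "ascending l' m'"
    and W: "a @ [l, m] @ b \<in> W"
  shows "word a * relator l m * word b - word a' * relator l' m' * word b'
    \<in> lower_span (a @ [l, m] @ b)"
  using assms
proof (induction "length a" "length a'" arbitrary: a l m b a' l' m' b' rule: linorder_wlog)
  case sym
  then show ?case
    using poly.subspace_neg[OF subspace_lower_span] by (metis minus_diff_eq)
next
  case le
  then obtain t where t: "a' = a @ t" "[l, m] @ b = t @ [l', m'] @ b'"
    by (metis append_eq_append_conv_if append_take_drop_id append.assoc)
  note W = le.prems(4)
  \<comment> \<open>\<open>t\<close> is the offset of the second pair: the pairs coincide, share one
    letter, or are disjoint with \<open>c\<close> between them.\<close>
  consider "t = []" | x where "t = [x]" | x y c where "t = x # y # c"
    by (metis list.exhaust)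
  then show ?case
  proof cases
    case 1
    then show ?thesis using t by (simp add: poly.subspace_0[OF subspace_lower_span])
  next
    case 2
    then have *: "l' = m" "b = m' # b'" "t = [l]" using t by auto
    have "relator l m * word [m'] - word [l] * relator m m' \<in> lower_span [l, m, m']"
      by (rule overlap) (use le.prems * W in auto)
    then have "word a * (relator l m * word [m'] - word [l] * relator m m') * word b'
        \<in> lower_span (a @ [l, m, m'] @ b')"
      by (rule lower_span_context) (use W * in auto)
    moreover have "word a * (relator l m * word [m'] - word [l] * relator m m') * word b' =
      word a * relator l m * (word [m'] * word b') - (word a * word [l]) * relator m m' * word b'"
      by (simp only: left_diff_distrib right_diff_distrib mult.assoc)
    ultimately show ?thesis using * t by simp
  next
    case 3
    then have *: "t = l # m # c" "b = c @ [l', m'] @ b'" using t by auto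
    have "relator l m * word (c @ [l', m']) - word ([l, m] @ c) * relator l' m'
        \<in> lower_span ([l, m] @ c @ [l', m'])"
      by (rule disjoint) (use le.prems * W in auto)
    then have "word a * (relator l m * word (c @ [l', m']) - word ([l, m] @ c) * relator l' m') * word b'
        \<in> lower_span (a @ ([l, m] @ c @ [l', m']) @ b')"
      by (rule lower_span_context) (use W * in auto)
    moreover have "word a * (relator l m * word (c @ [l', m']) - word ([l, m] @ c) * relator l' m') * word b' =
      word a * relator l m * (word (c @ [l', m']) * word b') -
      (word a * word ([l, m] @ c)) * relator l' m' * word b'"
      by (simp only: left_diff_distrib right_diff_distrib mult.assoc)
    ultimately show ?thesis using * t by simp
  qed
qed
end

section \<open>Independence and spanning for systems of representatives\<close>

context lie2_basis
begin

definition reduct_of :: "'i letter list \<Rightarrow> ('i letter list \<Rightarrow>\<^sub>0 'k) \<Rightarrow> bool" where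
  "reduct_of v e \<longleftrightarrow>
     (\<exists>a l m b. v = a @ [l, m] @ b \<and> ascending l m \<and> e = word a * relator l m * word b)"

text \<open>One relator multiple is fixed for each reducible word, so that the chosen elements have
  pairwise distinct leading words.\<close>

definition rewrite_rule :: "'i letter list \<Rightarrow> 'i letter list \<Rightarrow>\<^sub>0 'k" where
  "rewrite_rule v = (SOME e. reduct_of v e)"

definition all_translates :: "('i letter list \<Rightarrow>\<^sub>0 'k) set" where
  "all_translates = {word a * relator l m * word b | a l m b.
     a \<in> W \<and> b \<in> W \<and> l \<in> letters I \<and> m \<in> letters I}"

lemma reduct_of_rewrite_rule: "reducible v \<Longrightarrow> reduct_of v (rewrite_rule v)"
  unfolding rewrite_rule_def by (rule someI_ex) (auto simp: reducible_def reduct_of_def)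

text \<open>By confluence any two reducts of \<open>v\<close> differ by multiples of relators with
  smaller leading words, which the induction hypothesis covers.\<close>

lemma reduct_of_in_span_rules:
  "v \<in> W \<Longrightarrow> reduct_of v e \<Longrightarrow> e \<in> poly.span (rewrite_rule ` {w \<in> W. reducible w})"
proof (induction v arbitrary: e rule: wf_induct_rule[OF wf_word_less])
  case (1 v)
  let ?R = "poly.span (rewrite_rule ` {w \<in> W. reducible w})"
  obtain a l m b where e: "v = a @ [l, m] @ b" "ascending l m" "e = word a * relator l m * word b"
    using 1(3) by (auto simp: reduct_of_def)
  then have red: "reducible v" by (auto simp: reducible_def)
  obtain a' l' m' b' where e': "v = a' @ [l', m'] @ b'" "ascending l' m'"
    "rewrite_rule v = word a' * relator l' m' * word b'"
    using reduct_of_rewrite_rule[OF red] by (auto simp: reduct_of_def)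
  have "e - rewrite_rule v \<in> lower_span v"
    using confluence[of a l m b a' l' m' b'] e e' 1(2) by metis
  moreover have "translates v \<subseteq> ?R"
  proof
    fix q assume "q \<in> translates v"
    then obtain c n p d where q: "q = word c * relator n p * word d" "ascending n p" "c \<in> W" "d \<in> W"
      "n \<in> letters I" "p \<in> letters I" "word_less (c @ [n, p] @ d) v"
      unfolding translates_def by blast
    then have "reduct_of (c @ [n, p] @ d) q" by (auto simp: reduct_of_def)
    then show "q \<in> ?R" using 1(1)[of "c @ [n, p] @ d" q] q by auto
  qed
  then have "lower_span v \<subseteq> ?R"
    unfolding lower_span_def by (rule poly.span_minimal) simp
  ultimately have "e - rewrite_rule v \<in> ?R" by blast
  moreover have "rewrite_rule v \<in> ?R"
    using red 1(2) by (auto intro: poly.span_base)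
  ultimately have "(e - rewrite_rule v) + rewrite_rule v \<in> ?R" by (rule poly.span_add)
  then show ?case by simp
qed

lemma all_translates_in_span_rules:
  "all_translates \<subseteq> poly.span (rewrite_rule ` {w \<in> W. reducible w})"
proof
  let ?R = "poly.span (rewrite_rule ` {w \<in> W. reducible w})"
  fix q assume "q \<in> all_translates"
  then obtain a l m b where q: "q = word a * relator l m * word b" "a \<in> W" "b \<in> W"
    "l \<in> letters I" "m \<in> letters I"
    unfolding all_translates_def by blast
  show "q \<in> ?R"
  proof (cases "exchangeable l m")
    case False
    then have "relator l m = 0" by (cases l; cases m) auto
    then show ?thesis by (simp add: q(1) poly.span_zero)
  next
    case True
    show ?thesis
    proof (cases "index l" "index m" rule: linorder_cases)
      case less
      then show ?thesis
        using True q by (intro reduct_of_in_span_rules[of "a @ [l, m] @ b"])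
          (auto simp: reduct_of_def ascending_def)
    next
      case equal
      then show ?thesis by (simp add: q(1) relator_same_index poly.span_zero)
    next
      case greater
      then have "ascending (with_index l m) (with_index m l)"
        using True by (cases l; cases m) (auto simp: ascending_def)
      then have "reduct_of (a @ exchange l m @ b)
          (word a * relator (with_index l m) (with_index m l) * word b)"
        by (auto simp: reduct_of_def)
      then have "word a * relator (with_index l m) (with_index m l) * word b \<in> ?R"
        using q by (intro reduct_of_in_span_rules) (auto simp: letters_with_index)
      then show ?thesis
        using poly.span_neg by (fastforce simp: relator_exchange q(1))
    qed
  qed
qed

text \<open>Modulo lower layers, a reduct identifies two words of the same content.\<close>

lemma reduct_of_expand:
  assumes "reduct_of v e" "v \<in> W"
  obtains v' r where "e = word v - word v' + r" "word_less v' v" "content v' = content v" "v' \<in> W"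
    "Poly_Mapping.keys r \<subseteq> {w \<in> W. layer_less w v}" "e \<in> all_translates"
proof -
  obtain a l m b where e: "v = a @ [l, m] @ b" "ascending l m" "e = word a * relator l m * word b"
    using assms(1) by (auto simp: reduct_of_def)
  have lm: "l \<in> letters I" "m \<in> letters I" "exchangeable l m"
    using e assms(2) by (auto simp: ascending_def)
  have "w \<in> W \<and> layer_less w v" if w: "w \<in> Poly_Mapping.keys (word a * low l m * word b)" for w
  proof -
    obtain u where u: "w = a @ u @ b" "u \<in> Poly_Mapping.keys (low l m)"
    proof -
      obtain x where x: "x \<in> Poly_Mapping.keys (word a * low l m)" "w = x @ b"
        using w keys_mult[of "word a * low l m" "word b"] by (fastforce simp: plus_list_def)
      then obtain u where "u \<in> Poly_Mapping.keys (low l m)" "x = a @ u"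
        using keys_mult[of "word a" "low l m"] by (fastforce simp: plus_list_def)
      with x show ?thesis using that by simp
    qed
    then show ?thesis
      using keys_low[of l m u] lm layer_less_context[of u "[l, m]" a b] e assms(2)
      by (auto simp: letters_iff)
  qed
  moreover have "e = word v - word (a @ exchange l m @ b) + word a * low l m * word b"
    by (simp add: e relator_eq algebra_simps)
  moreover have "e \<in> all_translates"
    using e assms(2) unfolding all_translates_def by auto
  ultimately show ?thesis
    using word_less_context[OF word_less_exchange[OF e(2)], of a b] content_exchange[OF lm(3), of a b]
      e(1) lm assms(2) letters_with_index
    by (intro that[of "a @ exchange l m @ b" "word a * low l m * word b"]) auto
qed

text \<open>
  A nonzero combination of rewriting rules has, in its highest layer, coefficients summing to 0
  over each content; if it is supported on words with pairwise distinct contents, its highest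
  layer vanishes.
\<close>

lemma independence:
  assumes inj: "inj_on content S" and p: "p \<in> poly.span all_translates"
    and keys: "Poly_Mapping.keys p \<subseteq> S"
  shows "p = 0"
proof (rule ccontr)
  assume "p \<noteq> 0"
  let ?R = "{w \<in> W. reducible w}"
  have "p \<in> poly.span (rewrite_rule ` ?R)"
    using p poly.span_minimal[OF all_translates_in_span_rules] by auto
  then obtain t r where t: "finite t" "t \<subseteq> rewrite_rule ` ?R" "p = (\<Sum>e\<in>t. poly_scale (r e) e)"
    unfolding poly.span_explicit by blast
  define t' where "t' = {e \<in> t. r e \<noteq> 0}"
  have "t' \<subseteq> rewrite_rule ` ?R" using t(2) by (auto simp: t'_def)
  \<comment> \<open>One word is picked for each vector in the combination, which becomes a sum
    indexed by words.\<close>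
  then obtain T where T: "T \<subseteq> ?R" "inj_on rewrite_rule T" "t' = rewrite_rule ` T"
    unfolding subset_image_inj by blast
  define c where "c v = r (rewrite_rule v)" for v
  have "finite t'" using t(1) by (simp add: t'_def)
  then have fin: "finite T" using T(2,3) finite_imageD by blast
  have c0: "c v \<noteq> 0" if "v \<in> T" for v
    using that T(3) by (auto simp: c_def t'_def)
  have "p = (\<Sum>e\<in>t'. poly_scale (r e) e)"
    unfolding t(3) t'_def by (rule sum.mono_neutral_right) (use t(1) in auto)
  then have p_eq: "p = (\<Sum>v\<in>T. poly_scale (c v) (rewrite_rule v))"
    by (simp add: T(3) sum.reindex[OF T(2)] c_def)
  with \<open>p \<noteq> 0\<close> have "T \<noteq> {}" by auto
  have "asymp_on T word_less"
    by (rule asymp_onI) (use word_less_irrefl word_less_trans in blast)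
  moreover have "transp_on T word_less"
    by (rule transp_onI) (rule word_less_trans)
  ultimately have "\<exists>m\<in>T. \<forall>v\<in>T. v \<noteq> m \<longrightarrow> \<not> word_less m v"
    by (rule Finite_Set.bex_max_element[OF fin _ _ \<open>T \<noteq> {}\<close>])
  then
  obtain v0 where "v0 \<in> T" "\<forall>v\<in>T. v \<noteq> v0 \<longrightarrow> \<not> word_less v0 v" by blast
  then have v0: "v0 \<in> T" "\<And>v. v \<in> T \<Longrightarrow> \<not> word_less v0 v"
    using word_less_irrefl[of v0] by auto
  have "\<forall>v\<in>T. \<exists>v' r. rewrite_rule v = word v - word v' + r \<and> word_less v' v \<and>
      content v' = content v \<and> Poly_Mapping.keys r \<subseteq> {w \<in> W. layer_less w v}"
  proof
    fix v assume "v \<in> T"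
    then have "reduct_of v (rewrite_rule v)" "v \<in> W"
      using T(1) reduct_of_rewrite_rule by auto
    then show "\<exists>v' r. rewrite_rule v = word v - word v' + r \<and> word_less v' v \<and>
        content v' = content v \<and> Poly_Mapping.keys r \<subseteq> {w \<in> W. layer_less w v}"
      by (rule reduct_of_expand) blast
  qed
  from bchoice[OF this] obtain sw where "\<forall>v\<in>T. \<exists>r. rewrite_rule v = word v - word (sw v) + r \<and>
      word_less (sw v) v \<and> content (sw v) = content v \<and>
      Poly_Mapping.keys r \<subseteq> {w \<in> W. layer_less w v}" ..
  from bchoice[OF this] obtain lo where lo: "\<forall>v\<in>T. rewrite_rule v = word v - word (sw v) + lo v \<and>
      word_less (sw v) v \<and> content (sw v) = content v \<and>
      Poly_Mapping.keys (lo v) \<subseteq> {w \<in> W. layer_less w v}" ..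
  then have sl: "\<And>v. v \<in> T \<Longrightarrow> rewrite_rule v = word v - word (sw v) + lo v"
    "\<And>v. v \<in> T \<Longrightarrow> word_less (sw v) v" "\<And>v. v \<in> T \<Longrightarrow> content (sw v) = content v"
    "\<And>v. v \<in> T \<Longrightarrow> Poly_Mapping.keys (lo v) \<subseteq> {w \<in> W. layer_less w v}"
    by simp_all
  \<comment> \<open>Otherwise the layer of \<open>v0\<close>, which is that of \<open>w\<close>,
    would be below that of \<open>v\<close>, against the maximality of \<open>v0\<close>.\<close>
  have lo0: "Poly_Mapping.lookup (lo v) w = 0" if "v \<in> T" "content w = content v0" for v w
  proof (rule ccontr)
    assume "Poly_Mapping.lookup (lo v) w \<noteq> 0"
    then have "layer_less w v" using sl(4)[OF that(1)] by (auto simp: in_keys_iff)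
    then have "layer_less v0 v" using layer_less_content_cong[OF that(2)] by blast
    then show False using v0(2)[OF that(1)] layer_less_imp_word_less by blast
  qed
  have lookup_p: "Poly_Mapping.lookup p w =
      (\<Sum>v\<in>T. c v * ((if v = w then 1 else 0) - (if sw v = w then 1 else 0)))"
    if "content w = content v0" for w
    unfolding p_eq lookup_sum
    by (rule sum.cong) (use that in \<open>auto simp: sl(1) lookup_add lookup_minus lookup_single when_def lo0\<close>)
  \<comment> \<open>No \<open>sw v\<close> equals \<open>v0\<close>, since \<open>sw v\<close> lies
    below \<open>v\<close>.\<close>
  have p0: "Poly_Mapping.lookup p v0 = c v0"
  proof -
    have "Poly_Mapping.lookup p v0 = (\<Sum>v\<in>T. if v = v0 then c v else 0)"
      unfolding lookup_p[OF refl] by (rule sum.cong) (use sl(2) v0 in auto)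
    then show ?thesis using fin v0(1) by simp
  qed
  \<comment> \<open>The words in the content class of \<open>v0\<close> that can carry a
    coefficient. As \<open>sw\<close> preserves contents, \<open>v\<close> and \<open>sw v\<close>
    are in \<open>K\<close> together or not at all, and each rule adds 0 to the total.\<close>
  define K where "K = {w \<in> T \<union> sw ` T. content w = content v0}"
  have finK: "finite K" using fin by (simp add: K_def)
  have "(\<Sum>w\<in>K. Poly_Mapping.lookup p w) =
      (\<Sum>w\<in>K. \<Sum>v\<in>T. c v * ((if v = w then 1 else 0) - (if sw v = w then 1 else 0)))"
    by (rule sum.cong) (auto simp: K_def lookup_p)
  also have "\<dots> = (\<Sum>v\<in>T. c v * ((if v \<in> K then 1 else 0) - (if sw v \<in> K then 1 else 0)))"
    by (subst sum.swap) (simp add: finK sum_subtractf flip: sum_distrib_left)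
  also have "\<dots> = 0"
    by (rule sum.neutral) (auto simp: K_def sl(3))
  finally have "(\<Sum>w\<in>K. Poly_Mapping.lookup p w) = 0" .
  moreover have "(\<Sum>w\<in>K. Poly_Mapping.lookup p w) = (\<Sum>w\<in>{v0}. Poly_Mapping.lookup p w)"
  proof (rule sum.mono_neutral_right[OF finK])
    show "{v0} \<subseteq> K" using v0(1) by (simp add: K_def)
    \<comment> \<open>Hence \<open>v0\<close> is the only element of \<open>S\<close> with its
      content, and the total over \<open>K\<close> is the nonzero coefficient at
      \<open>v0\<close>.\<close>
    have "v0 \<in> S" using keys p0 c0[OF v0(1)] by (auto simp: in_keys_iff)
    then show "\<forall>w\<in>K - {v0}. Poly_Mapping.lookup p w = 0"
      using keys inj by (auto simp: in_keys_iff K_def dest: inj_onD)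
  qed
  ultimately show False using p0 c0[OF v0(1)] by simp
qed

text \<open>One rewriting step keeps the content, hence the layer, so errors made on the way down
  stay in layers below that of \<open>v\<close>.\<close>

lemma exists_normal_word:
  "v \<in> W \<Longrightarrow> \<exists>n. n \<in> W \<and> \<not> reducible n \<and> content n = content v \<and>
     word v - word n \<in> poly.span (all_translates \<union> word ` {w \<in> W. layer_less w v})"
proof (induction v rule: wf_induct_rule[OF wf_word_less])
  case (1 v)
  let ?Z = "poly.span (all_translates \<union> word ` {w \<in> W. layer_less w v})"
  show ?case
  proof (cases "reducible v")
    case False
    then show ?thesis using 1(2) by (auto intro!: exI[of _ v] poly.span_zero)
  next
    case True
    then obtain v' r where v': "rewrite_rule v = word v - word v' + r" "word_less v' v"
      "content v' = content v" "v' \<in> W" "Poly_Mapping.keys r \<subseteq> {w \<in> W. layer_less w v}"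
      "rewrite_rule v \<in> all_translates"
      using reduct_of_expand[OF reduct_of_rewrite_rule[OF True] 1(2)] by blast
    obtain n where n: "n \<in> W" "\<not> reducible n" "content n = content v'"
      "word v' - word n \<in> poly.span (all_translates \<union> word ` {w \<in> W. layer_less w v'})"
      using 1(1)[of v'] v' by blast
    have 1: "r \<in> ?Z"
      using poly_in_span_words[OF v'(5)] poly.span_mono[OF Un_upper2] by blast
    have 2: "rewrite_rule v \<in> ?Z" using v'(6) by (simp add: poly.span_base)
    have 3: "word v' - word n \<in> ?Z"
      using n(4) by (simp add: layer_less_content_cong_right[OF v'(3)])
    have "rewrite_rule v - r + (word v' - word n) \<in> ?Z"
      by (rule poly.span_add[OF poly.span_diff[OF 2 1] 3])
    then have "word v - word n \<in> ?Z" by (simp add: v'(1))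
    then show ?thesis using n v'(3) by auto
  qed
qed

text \<open>A word and the representative of its content have the same irreducible form, so they are
  congruent up to lower layers, where the induction hypothesis applies.\<close>

lemma spanning:
  assumes S: "S \<subseteq> W" "\<And>v. v \<in> W \<Longrightarrow> \<exists>z\<in>S. content z = content v"
  shows "v \<in> W \<Longrightarrow> word v \<in> poly.span (all_translates \<union> word ` S)"
proof (induction v rule: wf_induct_rule[OF wf_layer_less])
  case (1 v)
  let ?Z = "poly.span (all_translates \<union> word ` S)"
  have lower: "poly.span (all_translates \<union> word ` {w \<in> W. layer_less w v}) \<subseteq> ?Z"
    by (rule poly.span_minimal) (use 1(1) in \<open>auto intro: poly.span_base\<close>)
  obtain z where z: "z \<in> S" "content z = content v" using S(2) 1(2) by blast
  obtain n where n: "\<not> reducible n" "content n = content v"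
    "word v - word n \<in> poly.span (all_translates \<union> word ` {w \<in> W. layer_less w v})"
    using exists_normal_word[OF 1(2)] by blast
  have "z \<in> W" using z(1) S(1) by blast
  then obtain n' where n': "\<not> reducible n'" "content n' = content z"
    "word z - word n' \<in> poly.span (all_translates \<union> word ` {w \<in> W. layer_less w z})"
    using exists_normal_word by blast
  have "n' = n" using normal_eqI n(1,2) n'(1,2) z(2) by metis
  then have "word z - word n \<in> ?Z"
    using lower n'(3) layer_less_content_cong_right[OF z(2)] by auto
  moreover have "word v - word n \<in> ?Z" using lower n(3) by auto
  moreover have "word z \<in> ?Z" using z(1) by (simp add: poly.span_base)
  ultimately have "(word v - word n) - (word z - word n) + word z \<in> ?Z"
    by (metis poly.span_add poly.span_diff)
  then show ?case by simp
qed

end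

section \<open>The words in \<open>L\<close> represent each content exactly once\<close>

fun block_word :: "('i list \<times> 'i list) \<Rightarrow> 'i letter list" where
  "block_word (ks, js) = map Primed ks @ map Unprimed js"

text \<open>One factor u_i w_i of a word in \<open>L'\<close>. The last entries are the minimum of
  \<open>ks\<close> and the maximum of \<open>js\<close>. In \<open>proper_blocks\<close>,
  \<open>butlast\<close> appears because only w_s may be empty.\<close>

definition proper_block :: "'i::wellorder set \<Rightarrow> ('i list \<times> 'i list) \<Rightarrow> bool" where
  "proper_block I = (\<lambda>(ks, js). ks \<noteq> [] \<and> set ks \<subseteq> I \<and> set js \<subseteq> I \<and> sorted_wrt (\<ge>) ks \<and> sorted js \<and>
     (js = [] \<or> last js \<le> last ks))"

definition proper_blocks :: "'i::wellorder set \<Rightarrow> ('i list \<times> 'i list) list \<Rightarrow> bool" where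
  "proper_blocks I bs \<longleftrightarrow> (\<forall>b\<in>set bs. proper_block I b) \<and> (\<forall>b\<in>set (butlast bs). snd b \<noteq> [])"

fun block_content :: "('i list \<times> 'i list) \<Rightarrow> nat \<times> 'i multiset" where
  "block_content (ks, js) = (length ks, mset ks + mset js)"

lemma L'_subset:
  "L' I \<subseteq> {map Unprimed js @ concat (map block_word bs) | js bs.
     set js \<subseteq> I \<and> sorted js \<and> proper_blocks I bs}"
proof
  fix x assume "x \<in> L' I"
  then obtain s :: nat and w u where x: "x = w 0 @ concat (map (\<lambda>i. u i @ w i) [1..<Suc s])"
    and s: "1 \<le> s" and w: "\<forall>i\<in>{1..<s}. w i \<in> MX I - {[]}" "w 0 \<in> MX I" "w s \<in> MX I"
    and u: "\<forall>i\<in>{1..s}. u i \<in> MX' I - {[]}"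
    and le: "\<forall>i\<in>{1..<s}. last_index (w i) \<le> last_index (u i)"
      "w s = [] \<or> last_index (w s) \<le> last_index (u s)"
    unfolding L'_def by blast
  have MX: "w = map Unprimed (map index w) \<and> set (map index w) \<subseteq> I \<and> sorted (map index w)"
    if "w \<in> MX I" for w
    using that unfolding MX_def by (elim CollectE exE conjE) (simp add: comp_def)
  have MX': "u = map Primed (map index u) \<and> set (map index u) \<subseteq> I \<and> sorted_wrt (\<ge>) (map index u)"
    if "u \<in> MX' I" for u
    using that unfolding MX'_def by (elim CollectE exE conjE) (simp add: comp_def)
  have wi: "w i \<in> MX I" if "i \<in> {1..s}" for i
    using that w by (cases "i = s") auto
  have le': "w i = [] \<or> last_index (w i) \<le> last_index (u i)" if "i \<in> {1..s}" for i
    using that le by (cases "i = s") auto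
  define bs where "bs = map (\<lambda>i. (map index (u i), map index (w i))) [1..<Suc s]"
  have "concat (map block_word bs) = concat (map (\<lambda>i. u i @ w i) [1..<Suc s])"
  proof -
    have "map block_word bs = map (\<lambda>i. u i @ w i) [1..<Suc s]"
      unfolding bs_def map_map
    proof (rule map_cong[OF refl])
      fix i assume "i \<in> set [1..<Suc s]"
      then have "i \<in> {1..s}" by auto
      then show "(block_word \<circ> (\<lambda>i. (map index (u i), map index (w i)))) i = u i @ w i"
        using MX[OF wi] MX'[of "u i"] u by auto
    qed
    then show ?thesis by simp
  qed
  moreover have "proper_blocks I bs"
    unfolding proper_blocks_def
  proof (intro conjI ballI)
    fix b assume "b \<in> set bs"
    then obtain i where "b = (map index (u i), map index (w i))" "i \<in> set [1..<Suc s]"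
      unfolding bs_def set_map by (elim imageE)
    then have i: "i \<in> {1..s}" "b = (map index (u i), map index (w i))" by auto
    then show "proper_block I b"
      using MX[OF wi[OF i(1)]] MX'[of "u i"] u le'[OF i(1)]
      by (cases "w i = []") (auto simp: proper_block_def last_index_def last_map)
  next
    fix b assume "b \<in> set (butlast bs)"
    then have "b \<in> set (map (\<lambda>i. (map index (u i), map index (w i))) [1..<s])"
      using s by (simp add: bs_def)
    then show "snd b \<noteq> []" using w by auto
  qed
  ultimately show "x \<in> {map Unprimed js @ concat (map block_word bs) | js bs.
     set js \<subseteq> I \<and> sorted js \<and> proper_blocks I bs}"
    using x MX[OF w(2)] by (intro CollectI exI[of _ "map index (w 0)"] exI[of _ bs]) auto
qed

lemma block_words_in_L:
  assumes "set js \<subseteq> I" "sorted js" "proper_blocks I bs"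
  shows "map Unprimed js @ concat (map block_word bs) \<in> L I"
proof (cases "bs = []")
  case True
  then show ?thesis using assms by (auto simp: L_def MX_def)
next
  case False
  define s where "s = length bs"
  \<comment> \<open>The factors u_i, w_i count from 1 and list positions from 0; w_0 belongs to no
    block.\<close>
  define u where "u i = map Primed (fst (bs ! (i - 1)))" for i
  define w where "w i = (if i = 0 then map Unprimed js else map Unprimed (snd (bs ! (i - 1))))" for i
  have block: "proper_block I (bs ! (i - 1))" if "i \<in> {1..s}" for i
    using assms(3) that by (auto simp: proper_blocks_def s_def)
  have nonempty: "snd (bs ! (i - 1)) \<noteq> []" if "i \<in> {1..<s}" for i
  proof -
    have "bs ! (i - 1) = butlast bs ! (i - 1)" "i - 1 < length (butlast bs)"
      using that by (auto simp: nth_butlast s_def)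
    then show ?thesis using assms(3) nth_mem unfolding proper_blocks_def by metis
  qed
  have "map block_word bs = map (\<lambda>i. u i @ w i) [1..<Suc s]"
  proof (rule nth_equalityI)
    fix i assume "i < length (map block_word bs)"
    then show "map block_word bs ! i = map (\<lambda>i. u i @ w i) [1..<Suc s] ! i"
      by (cases "bs ! i") (simp add: s_def u_def w_def del: upt_Suc)
  qed (use False in \<open>simp add: s_def Suc_le_eq\<close>)
  then have eq: "map Unprimed js @ concat (map block_word bs) =
      w 0 @ concat (map (\<lambda>i. u i @ w i) [1..<Suc s])"
    by (simp add: w_def)
  have s: "1 \<le> s" using False by (simp add: s_def Suc_le_eq)
  have w0: "w 0 \<in> MX I" using assms(1,2) by (auto simp: w_def MX_def)
  have wMX: "w i \<in> MX I" if "i \<in> {1..s}" for i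
    using block[OF that] that by (auto simp: w_def MX_def proper_block_def)
  have wne: "w i \<noteq> []" if "i \<in> {1..<s}" for i
    using nonempty[OF that] that by (simp add: w_def)
  have uMX: "u i \<in> MX' I - {[]}" if "i \<in> {1..s}" for i
    using block[OF that] by (auto simp: u_def MX'_def proper_block_def)
  have le: "w i = [] \<or> last_index (w i) \<le> last_index (u i)" if "i \<in> {1..s}" for i
  proof (cases "snd (bs ! (i - 1)) = []")
    case False
    then show ?thesis using block[OF that] that
      by (auto simp: u_def w_def last_index_def proper_block_def last_map)
  qed (use that in \<open>simp add: w_def\<close>)
  have 1: "\<forall>i\<in>{1..<s}. w i \<in> MX I - {[]}"
    using wMX wne by auto
  have 2: "\<forall>i\<in>{1..<s}. last_index (w i) \<le> last_index (u i)"
  proof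
    fix i assume "i \<in> {1..<s}"
    then show "last_index (w i) \<le> last_index (u i)" using le[of i] wne[of i] by auto
  qed
  have "map Unprimed js @ concat (map block_word bs) \<in> L' I"
    unfolding L'_def using eq 1 2 s w0 wMX[of s] uMX le[of s]
    by (intro CollectI exI[of _ s] exI[of _ w] exI[of _ u] conjI) simp_all
  then show ?thesis by (simp add: L_def)
qed

lemma L_eq:
  "L I = {map Unprimed js @ concat (map block_word bs) | js bs.
     set js \<subseteq> I \<and> sorted js \<and> proper_blocks I bs}"
proof
  show "L I \<subseteq> {map Unprimed js @ concat (map block_word bs) | js bs.
     set js \<subseteq> I \<and> sorted js \<and> proper_blocks I bs}"
    unfolding L_def
  proof (rule Un_least[OF _ L'_subset], rule subsetI)
    fix x assume "x \<in> MX I"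
    then obtain js where "x = map Unprimed js" "set js \<subseteq> I" "sorted js" by (auto simp: MX_def)
    then show "x \<in> {map Unprimed js @ concat (map block_word bs) | js bs.
       set js \<subseteq> I \<and> sorted js \<and> proper_blocks I bs}"
      by (intro CollectI exI[of _ js] exI[of _ "[]"]) (simp add: proper_blocks_def)
  qed
qed (auto intro: block_words_in_L)

lemma L_subset_lists: "L I \<subseteq> lists (letters I)"
  unfolding L_eq by (fastforce simp: letters_def proper_blocks_def proper_block_def)

section \<open>Contents of the words in \<open>L\<close>\<close>

lemma content_unprimed:
  assumes "\<And>a M C. content v = (a, M) # C \<Longrightarrow> a \<noteq> 0"
  shows "content (map Unprimed js @ v) = (if js = [] then [] else [(0, mset js)]) @ content v"
proof (induction js)
  case (Cons j js)
  then show ?case using assms by (cases "content v"; cases js) auto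
qed simp

lemma content_primed:
  assumes "content v = (0, M) # C"
  shows "content (map Primed ks @ v) = (length ks, mset ks + M) # C"
  by (induction ks) (use assms in auto)

lemma content_primed_only: "ks \<noteq> [] \<Longrightarrow> content (map Primed ks) = [(length ks, mset ks)]"
proof (induction ks)
  case (Cons k ks)
  then show ?case by (cases ks) auto
qed simp

text \<open>Every block but the last ends in an unprimed letter, so neighbouring blocks do not
  merge.\<close>

lemma content_blocks_words:
  assumes "proper_blocks I bs"
  shows "content (concat (map block_word bs)) = map block_content bs"
  using assms
proof (induction bs)
  case (Cons b bs)
  obtain ks js where b: "b = (ks, js)" by fastforce
  have bs: "proper_blocks I bs" and ks: "ks \<noteq> []" and js: "bs \<noteq> [] \<Longrightarrow> js \<noteq> []"
    using Cons.prems by (auto simp: proper_blocks_def proper_block_def b split: if_splits)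
  have "a \<noteq> 0" if "content (concat (map block_word bs)) = (a, M) # C" for a M C
    using that bs unfolding Cons.IH[OF bs]
    by (cases bs) (auto simp: proper_blocks_def proper_block_def)
  then have *: "content (map Unprimed js @ concat (map block_word bs)) =
      (if js = [] then [] else [(0, mset js)]) @ map block_content bs"
    using content_unprimed[of "concat (map block_word bs)" js] Cons.IH[OF bs] by simp
  show ?case
  proof (cases "js = []")
    case True
    then have "bs = []" using js by blast
    with True show ?thesis using ks by (simp add: b content_primed_only)
  next
    case False
    then show ?thesis using content_primed[OF *[simplified False if_False append_Cons append_Nil]]
      by (simp add: b)
  qed
qed simp

lemma content_L_word:
  assumes "proper_blocks I bs"
  shows "content (map Unprimed js @ concat (map block_word bs)) =
    (if js = [] then [] else [(0, mset js)]) @ map block_content bs"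
proof -
  have "a \<noteq> 0" if "content (concat (map block_word bs)) = (a, M) # C" for a M C
    using that assms unfolding content_blocks_words[OF assms]
    by (cases bs) (auto simp: proper_blocks_def proper_block_def)
  then show ?thesis
    using content_unprimed[of "concat (map block_word bs)" js] content_blocks_words[OF assms] by simp
qed

lemma proper_block_sorted:
  assumes "proper_block I (ks, js)"
  shows "sorted (js @ rev ks)"
proof -
  have ks: "ks \<noteq> []" "sorted (rev ks)" and js: "sorted js" "js = [] \<or> last js \<le> last ks"
    using assms by (auto simp: proper_block_def sorted_wrt_rev)
  have "last ks \<le> k" if "k \<in> set ks" for k
    using ks that by (cases ks rule: rev_cases) auto
  moreover have "j \<le> last js" if "j \<in> set js" for j
    using js that by (cases js rule: rev_cases) (auto simp: sorted_append)
  ultimately show ?thesis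
    using ks js by (fastforce simp: sorted_append intro: order_trans)
qed

text \<open>\<open>js @ rev ks\<close> is the sorted list of the multiset of the block, and the
  number of primed letters says where to cut it.\<close>

lemma block_content_inj:
  assumes "proper_block I b" "proper_block I b'" "block_content b = block_content b'"
  shows "b = b'"
proof -
  obtain ks js ks' js' where b: "b = (ks, js)" "b' = (ks', js')" by fastforce
  have len: "length (rev ks) = length (rev ks')" and "mset (js @ rev ks) = mset (js' @ rev ks')"
    using assms(3) by (auto simp: b add.commute)
  then have "js @ rev ks = js' @ rev ks'"
    using proper_block_sorted assms(1,2) unfolding b
    by (metis properties_for_sort)
  then show ?thesis using len b by simp
qed

lemma inj_on_content_L: "inj_on content (L I)"
proof (rule inj_onI)
  fix x y assume "x \<in> L I" "y \<in> L I" and eq: "content x = content y"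
  then obtain js bs js' bs' where x: "x = map Unprimed js @ concat (map block_word bs)"
      "sorted js" "proper_blocks I bs"
    and y: "y = map Unprimed js' @ concat (map block_word bs')" "sorted js'" "proper_blocks I bs'"
    unfolding L_eq by blast
  have eq': "(if js = [] then [] else [(0, mset js)]) @ map block_content bs =
      (if js' = [] then [] else [(0, mset js')]) @ map block_content bs'"
    using eq content_L_word[OF x(3)] content_L_word[OF y(3)] x(1) y(1) by simp
  have ne: "fst (block_content b) \<noteq> 0" if "b \<in> set bs \<union> set bs'" for b
    using that x(3) y(3) by (cases b) (auto simp: proper_blocks_def proper_block_def)
  have "mset js = mset js' \<and> map block_content bs = map block_content bs'"
  proof (cases "js = [] \<longleftrightarrow> js' = []")
    case True
    then show ?thesis using eq' by (auto split: if_splits)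
  next
    \<comment> \<open>One side then starts with a block without primed letters, which a proper block
      cannot match.\<close>
    case False
    then have "map block_content bs = (0, mset js') # map block_content bs' \<or>
        map block_content bs' = (0, mset js) # map block_content bs"
      using eq' by (auto split: if_splits)
    moreover have zero: "\<exists>b\<in>set cs. fst (block_content b) = 0"
      if "map block_content cs = (0, M) # ds" for cs :: "('a list \<times> 'a list) list" and M ds
      using that by (cases cs) simp_all
    ultimately show ?thesis
    proof (elim disjE)
      assume "map block_content bs = (0, mset js') # map block_content bs'"
      from zero[OF this] show ?thesis using ne by blast
    next
      assume "map block_content bs' = (0, mset js) # map block_content bs"
      from zero[OF this] show ?thesis using ne by blast
    qed
  qed
  moreover have "inj_on block_content (set bs \<union> set bs')"
    by (rule inj_onI, rule block_content_inj[of I]) (use x(3) y(3) in \<open>unfold proper_blocks_def, blast+\<close>)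
  ultimately have "js = js'" "bs = bs'"
    using x(2) y(2) properties_for_sort map_inj_on by metis+
  then show "x = y" using x(1) y(1) by simp
qed

section \<open>Words of \<open>L\<close> with a prescribed content\<close>

text \<open>A cut lies between an unprimed and a primed letter: a block after a cut has a primed
  letter, and one before a cut has an unprimed letter.\<close>

lemma content_shape:
  assumes "v \<in> lists (letters I)"
  shows "(\<forall>b\<in>set (tl (content v)). fst b \<noteq> 0) \<and>
    (\<forall>b\<in>set (butlast (content v)). fst b < size (snd b)) \<and>
    (\<forall>b\<in>set (content v). set_mset (snd b) \<subseteq> I)"
  using assms
proof (induction v)
  case (Cons l v)
  then have "index l \<in> I" by (auto simp: letters_def)
  moreover have "\<And>a M. (a, M) \<in> set (content v) \<Longrightarrow> a \<le> size M \<and> M \<noteq> {#}"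
    using content_blocks by blast
  ultimately show ?case using Cons
    by (cases "(l, content v)" rule: push.cases) (auto split: if_splits)
qed simp

definition canonical_block :: "nat \<times> 'i::wellorder multiset \<Rightarrow> 'i list \<times> 'i list" where
  "canonical_block = (\<lambda>(a, M). let s = sorted_list_of_multiset M
     in (rev (drop (size M - a) s), take (size M - a) s))"

lemma canonical_block:
  assumes "a \<noteq> 0" "a \<le> size M" "set_mset M \<subseteq> I"
  shows "proper_block I (canonical_block (a, M))" "block_content (canonical_block (a, M)) = (a, M)"
    "snd (canonical_block (a, M)) = [] \<longleftrightarrow> a = size M"
proof -
  define s where "s = sorted_list_of_multiset M"
  have s: "sorted s" "mset s = M" "length s = size M" "set s \<subseteq> I"
    using assms(3) by (auto simp: s_def simp flip: size_mset)
  let ?k = "size M - a"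
  have cb: "canonical_block (a, M) = (rev (drop ?k s), take ?k s)"
    by (simp add: canonical_block_def s_def Let_def)
  have ne: "drop ?k s \<noteq> []" using assms s(3) by auto
  have split: "sorted (take ?k s @ drop ?k s)" using s(1) by simp
  have "last (take ?k s) \<le> last (rev (drop ?k s))" if "take ?k s \<noteq> []"
    using split last_in_set[OF that] hd_in_set[OF ne] ne unfolding sorted_append last_rev by blast
  moreover have "sorted (take ?k s)" "sorted (drop ?k s)" using split unfolding sorted_append by auto
  moreover have "set (take ?k s) \<subseteq> I" "set (drop ?k s) \<subseteq> I"
    using s(4) set_take_subset[of ?k s] set_drop_subset[of ?k s] by auto
  ultimately show "proper_block I (canonical_block (a, M))"
    using ne unfolding cb proper_block_def case_prod_conv sorted_wrt_rev set_rev rev_is_Nil_conv by blast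
  have "mset (drop ?k s) + mset (take ?k s) = M"
    by (metis add.commute append_take_drop_id mset_append s(2))
  then show "block_content (canonical_block (a, M)) = (a, M)"
    using assms(2) s(3) by (simp add: cb)
  show "snd (canonical_block (a, M)) = [] \<longleftrightarrow> a = size M"
    using assms(1,2) s(3) by (auto simp: cb)
qed

lemma exists_L_word_with_content:
  fixes v :: "'i::wellorder letter list"
  assumes "v \<in> lists (letters I)"
  shows "\<exists>z\<in>L I. content z = content v"
proof -
  note shape = content_shape[OF assms]
  have blocks: "\<forall>b\<in>set (content v). fst b \<le> size (snd b) \<and> snd b \<noteq> {#}"
    using content_blocks by fastforce
  \<comment> \<open>A first block without primed letters becomes w_0; all other blocks are made
    canonical.\<close>
  obtain js D where eq: "content v = (if js = [] then [] else [(0, mset js)]) @ D"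
    and js: "sorted js" "set js \<subseteq> I" and D0: "\<forall>b\<in>set D. fst b \<noteq> 0"
    and DI: "\<forall>b\<in>set D. fst b \<le> size (snd b) \<and> set_mset (snd b) \<subseteq> I"
    and Dlast: "\<forall>b\<in>set (butlast D). fst b < size (snd b)"
  proof (cases "\<exists>M C. content v = (0, M) # C")
    case True
    then obtain M C where MC: "content v = (0, M) # C" by blast
    have "sorted_list_of_multiset M \<noteq> []"
    proof
      assume "sorted_list_of_multiset M = []"
      then have "M = {#}" by (metis mset.simps(1) mset_sorted_list_of_multiset)
      then show False using blocks MC by simp
    qed
    moreover have "\<forall>b\<in>set (butlast C). fst b < size (snd b)"
      using shape MC by (cases "C = []") auto
    ultimately show ?thesis
      using shape blocks MC by (intro that[of "sorted_list_of_multiset M" C]) simp_all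
  next
    case False
    then have "\<forall>b\<in>set (content v). fst b \<noteq> 0"
      using shape by (cases "content v") auto
    then show ?thesis using shape blocks by (intro that[of "[]" "content v"]) simp_all
  qed
  define bs where "bs = map canonical_block D"
  have content: "map block_content bs = D"
    unfolding bs_def map_map
  proof (rule map_idI)
    fix b assume "b \<in> set D"
    then show "(block_content \<circ> canonical_block) b = b"
      using D0 DI canonical_block(2)[of "fst b" "snd b" I] by simp
  qed
  have proper: "proper_blocks I bs"
    unfolding proper_blocks_def
  proof (intro conjI ballI)
    fix b assume "b \<in> set bs"
    then show "proper_block I b" using D0 DI by (fastforce simp: bs_def intro: canonical_block(1))
  next
    fix b assume "b \<in> set (butlast bs)"
    then obtain a M where aM: "(a, M) \<in> set (butlast D)" "b = canonical_block (a, M)"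
      by (auto simp: bs_def simp flip: map_butlast)
    then show "snd b \<noteq> []"
      using canonical_block(3)[of a M I] D0 DI Dlast in_set_butlastD[OF aM(1)] by fastforce
  qed
  then have "content (map Unprimed js @ concat (map block_word bs)) = content v"
    using content_L_word[OF proper] eq content by simp
  then show ?thesis using block_words_in_L[OF js(2,1) proper] by blast
qed

section \<open>The basis of the enveloping algebra\<close>

context lie2_basis
begin

abbreviation FA :: "('i letter list \<Rightarrow>\<^sub>0 'k) ring" where "FA \<equiv> free_algebra (letters I)"
abbreviation J :: "('i letter list \<Rightarrow>\<^sub>0 'k) set" where "J \<equiv> lie2_ideal scale br1 br2 I f"
abbreviation U :: "('k, ('i letter list \<Rightarrow>\<^sub>0 'k) set) module" where "U \<equiv> U_Lie2 scale br1 br2 I f"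
abbreviation coset :: "('i letter list \<Rightarrow>\<^sub>0 'k) \<Rightarrow> ('i letter list \<Rightarrow>\<^sub>0 'k) set" where
  "coset p \<equiv> J +>\<^bsub>FA\<^esub> p"

lemma FA_simps [simp]:
  "carrier FA = {p. Poly_Mapping.keys p \<subseteq> W}" "p \<otimes>\<^bsub>FA\<^esub> q = p * q" "p \<oplus>\<^bsub>FA\<^esub> q = p + q"
  "\<zero>\<^bsub>FA\<^esub> = 0"
  by (simp_all add: free_algebra_def)

lemma carrier_mult:
  assumes "Poly_Mapping.keys (p :: _ \<Rightarrow>\<^sub>0 'k) \<subseteq> W" "Poly_Mapping.keys q \<subseteq> W"
  shows "Poly_Mapping.keys (p * q) \<subseteq> W"
  using monoid.m_closed[OF ring.is_monoid[OF ring_free_algebra[of "letters I"]], of p q] assms by simp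

lemma FA_minus:
  assumes "Poly_Mapping.keys p \<subseteq> W"
  shows "\<ominus>\<^bsub>FA\<^esub> p = - p"
  using assms abelian_group.minus_equality[OF ring.is_abelian_group[OF ring_free_algebra[of "letters I"]], of "- p" p]
  by simp

lemma relator_in_relators:
  assumes "l \<in> letters I" "m \<in> letters I"
  shows "relator l m = 0 \<or> relator l m \<in> lie2_relators scale br1 br2 I f"
  using assms by (cases "(l, m)" rule: relator.cases) (auto simp: letters_iff relators_eq)

lemma relators_keys: "r \<in> lie2_relators scale br1 br2 I f \<Longrightarrow> Poly_Mapping.keys r \<subseteq> W"
  using lie2_relators_carrier[of scale br1 br2 I f] by auto

lemma subspace_carrier: "poly.subspace {p :: 'i letter list \<Rightarrow>\<^sub>0 'k. Poly_Mapping.keys p \<subseteq> W}"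
proof -
  have "{p :: 'i letter list \<Rightarrow>\<^sub>0 'k. Poly_Mapping.keys p \<subseteq> W} = poly.span (word ` W)"
    using poly_in_span_words keys_span_words by blast
  then show ?thesis by simp
qed

lemma all_translates_keys: "p \<in> all_translates \<Longrightarrow> Poly_Mapping.keys p \<subseteq> W"
proof -
  assume "p \<in> all_translates"
  then obtain a l m b where p: "p = word a * relator l m * word b" "a \<in> W" "b \<in> W"
    "l \<in> letters I" "m \<in> letters I"
    unfolding all_translates_def by blast
  have "Poly_Mapping.keys (relator l m) \<subseteq> W"
    using relator_in_relators[OF p(4,5)] relators_keys by auto
  then show ?thesis unfolding p(1) using p(2,3) by (intro carrier_mult) simp_all
qed

lemma span_translates_keys: "p \<in> poly.span all_translates \<Longrightarrow> Poly_Mapping.keys p \<subseteq> W"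
  using poly.span_minimal[OF _ subspace_carrier, of all_translates] all_translates_keys by blast

lemma span_translates_mult:
  assumes p: "p \<in> poly.span all_translates" and q: "Poly_Mapping.keys q \<subseteq> W"
  shows "q * p \<in> poly.span all_translates" "p * q \<in> poly.span all_translates"
proof -
  let ?S = "poly.span all_translates"
  have sub: "poly.subspace {x. a * x * b \<in> ?S}" for a b
    by (rule subspace_translate) simp
  have base: "word v * t \<in> ?S" "t * word v \<in> ?S" if t': "t \<in> all_translates" and v: "v \<in> W" for t v
  proof -
    obtain a l m b where t: "t = word a * relator l m * word b" "a \<in> W" "b \<in> W"
      "l \<in> letters I" "m \<in> letters I"
      using t' unfolding all_translates_def by blast
    have "word (v @ a) * relator l m * word b \<in> all_translates"
      unfolding all_translates_def using t v
      by (intro CollectI exI[of _ "v @ a"] exI[of _ l] exI[of _ m] exI[of _ b]) simp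
    moreover have "word a * relator l m * word (b @ v) \<in> all_translates"
      unfolding all_translates_def using t v
      by (intro CollectI exI[of _ a] exI[of _ l] exI[of _ m] exI[of _ "b @ v"]) simp
    moreover have "word v * t = word (v @ a) * relator l m * word b"
      "t * word v = word a * relator l m * word (b @ v)"
      by (simp_all only: t(1) mult.assoc word_mult[symmetric])
    ultimately show "word v * t \<in> ?S" "t * word v \<in> ?S" by (simp_all add: poly.span_base)
  qed
  have words: "word v * p \<in> ?S" "p * word v \<in> ?S" if "v \<in> W" for v
  proof -
    have 1: "all_translates \<subseteq> {x. word v * x * word [] \<in> ?S}"
      and 2: "all_translates \<subseteq> {x. word [] * x * word v \<in> ?S}"
      using base that by auto
    show "word v * p \<in> ?S" "p * word v \<in> ?S"
      using subsetD[OF poly.span_minimal[OF 1 sub] p] subsetD[OF poly.span_minimal[OF 2 sub] p] by simp_all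
  qed
  have q': "q \<in> poly.span (word ` W)" using q by (rule poly_in_span_words)
  have 1: "word ` W \<subseteq> {x. word [] * x * p \<in> ?S}" and 2: "word ` W \<subseteq> {x. p * x * word [] \<in> ?S}"
    using words by auto
  show "q * p \<in> ?S" "p * q \<in> ?S"
    using subsetD[OF poly.span_minimal[OF 1 sub] q'] subsetD[OF poly.span_minimal[OF 2 sub] q'] by simp_all
qed

text \<open>The span is closed under multiplication by words on both sides, hence an ideal
  containing the relators; conversely the ideal is a subspace, as scalars act by constant
  polynomials.\<close>

lemma ideal_eq: "J = poly.span all_translates"
proof
  let ?S = "poly.span all_translates"
  have ring: "ring FA" by (rule ring_free_algebra)
  interpret FA: ring FA by (rule ring)
  have "ideal ?S FA"
  proof (rule idealI[OF ring])
    show "subgroup ?S (add_monoid FA)"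
    proof (rule FA.add.subgroupI)
      show "?S \<subseteq> carrier FA" using span_translates_keys by auto
      show "?S \<noteq> {}" using poly.span_zero by blast
      show "\<ominus>\<^bsub>FA\<^esub> a \<in> ?S" if "a \<in> ?S" for a
        using FA_minus[OF span_translates_keys[OF that]] poly.span_neg[OF that] by simp
      show "a \<oplus>\<^bsub>FA\<^esub> b \<in> ?S" if "a \<in> ?S" "b \<in> ?S" for a b
        using poly.span_add[OF that] by simp
    qed
  qed (use span_translates_mult in auto)
  moreover have "lie2_relators scale br1 br2 I f \<subseteq> ?S"
  proof -
    have "relator l m \<in> ?S" if "l \<in> letters I" "m \<in> letters I" for l m
    proof -
      have "word [] * relator l m * word [] \<in> all_translates"
        unfolding all_translates_def using that by blast
      then show ?thesis by (simp add: poly.span_base)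
    qed
    then have "relator_UU (f i) (f j) \<in> ?S" "relator_PP (f i) (f j) \<in> ?S"
      "relator_PU (f i) (f j) \<in> ?S" if "i \<in> I" "j \<in> I" for i j
      using that relator.simps(1,2,3)[of i j] by (metis letters_iff letter.sel)+
    then show ?thesis by (auto simp: relators_eq)
  qed
  ultimately show "J \<subseteq> ?S"
    unfolding lie2_ideal_def by (rule FA.genideal_minimal)
  interpret J: ideal J FA by (rule ideal_lie2_ideal)
  have "poly.subspace J"
    unfolding poly.subspace_def
  proof (intro conjI ballI allI)
    show "0 \<in> J" using additive_subgroup.zero_closed[OF J.additive_subgroup_axioms] by simp
    show "x + y \<in> J" if "x \<in> J" "y \<in> J" for x y using additive_subgroup.a_closed[OF J.additive_subgroup_axioms that] by simp
    show "poly_scale c x \<in> J" if "x \<in> J" for c x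
      using J.I_l_closed[OF that, of "Poly_Mapping.single [] c"] by (simp add: poly_scale_def)
  qed
  moreover have "all_translates \<subseteq> J"
  proof
    fix p assume "p \<in> all_translates"
    then obtain a l m b where p: "p = word a * relator l m * word b" "a \<in> W" "b \<in> W"
      "l \<in> letters I" "m \<in> letters I"
      unfolding all_translates_def by blast
    have "relator l m \<in> J"
      using relator_in_relators[OF p(4,5)] additive_subgroup.zero_closed[OF J.additive_subgroup_axioms]
        FA.genideal_self[OF lie2_relators_carrier, of scale br1 br2 f]
      unfolding lie2_ideal_def by auto
    then have "word a * relator l m \<in> J"
      using J.I_l_closed[of "relator l m" "word a"] p(2) by simp
    then show "p \<in> J" using J.I_r_closed[of "word a * relator l m" "word b"] p(1,3) by simp
  qed
  ultimately show "?S \<subseteq> J" using poly.span_minimal by blast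
qed

lemma coset_eq_iff:
  assumes "Poly_Mapping.keys p \<subseteq> W" "Poly_Mapping.keys q \<subseteq> W"
  shows "coset p = coset q \<longleftrightarrow> p - q \<in> J"
proof -
  have "p \<ominus>\<^bsub>FA\<^esub> q = p - q" using FA_minus[OF assms(2)] by (simp add: a_minus_def)
  then show ?thesis
    using ring.quotient_eq_iff_same_a_r_cos[OF ring_free_algebra ideal_lie2_ideal, of p I q scale br1 br2 f] assms
    by simp
qed

lemma U_coset:
  assumes "Poly_Mapping.keys p \<subseteq> W"
  shows "coset p \<in> carrier U" "Poly_Mapping.keys q \<subseteq> W \<Longrightarrow> coset p \<oplus>\<^bsub>U\<^esub> coset q = coset (p + q)"
    "c \<odot>\<^bsub>U\<^esub> coset p = coset (poly_scale c p)"
proof -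
  interpret J: ideal J FA by (rule ideal_lie2_ideal)
  note hom = J.rcos_ring_hom
  show "coset p \<in> carrier U"
    using ring_hom_closed[OF hom, of p] assms by (simp add: U_Lie2_def quotient_algebra_def Let_def)
  show "coset p \<oplus>\<^bsub>U\<^esub> coset q = coset (p + q)" if "Poly_Mapping.keys q \<subseteq> W"
    using ring_hom_add[OF hom, of p q] assms that by (simp add: U_Lie2_def quotient_algebra_def Let_def)
  show "c \<odot>\<^bsub>U\<^esub> coset p = coset (poly_scale c p)"
    using ring_hom_mult[OF hom, of "Poly_Mapping.single [] c" p] assms
    by (simp add: U_Lie2_def quotient_algebra_def Let_def poly_scale_def)
qed

lemma U_zero: "\<zero>\<^bsub>U\<^esub> = coset 0"
proof -
  interpret J: ideal J FA by (rule ideal_lie2_ideal)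
  show ?thesis
    using J.a_rcos_zero[OF ideal_lie2_ideal additive_subgroup.zero_closed[OF J.additive_subgroup_axioms]]
    by (simp add: U_Lie2_def quotient_algebra_def Let_def FactRing_def)
qed

lemma carrier_U: "x \<in> carrier U \<Longrightarrow> \<exists>p. Poly_Mapping.keys p \<subseteq> W \<and> x = coset p"
  by (auto simp: U_Lie2_def quotient_algebra_def Let_def FactRing_def A_RCOSETS_defs a_r_coset_def)

lemma word_image_eq: "word_image scale br1 br2 I f w = coset (word w)"
  by (simp add: word_image_def)

lemma inj_on_word_image: "inj_on (word_image scale br1 br2 I f) (L I)"
proof (rule inj_onI)
  fix v w assume vw: "v \<in> L I" "w \<in> L I" "word_image scale br1 br2 I f v = word_image scale br1 br2 I f w"
  then have "v \<in> W" "w \<in> W" using L_subset_lists by auto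
  then have "word v - word w \<in> J" using vw(3) by (simp add: word_image_eq coset_eq_iff)
  moreover have keys: "Poly_Mapping.keys (word v - word w :: _ \<Rightarrow>\<^sub>0 'k) \<subseteq> L I"
    using vw(1,2) keys_diff[of "word v :: _ \<Rightarrow>\<^sub>0 'k" "word w"] by auto
  ultimately have "word v - word w = (0 :: _ \<Rightarrow>\<^sub>0 'k)"
    unfolding ideal_eq by (rule independence[OF inj_on_content_L])
  then have "word v = (word w :: _ \<Rightarrow>\<^sub>0 'k)" by simp
  from arg_cong[OF this, of Poly_Mapping.keys] show "v = w" by simp
qed

lemma basis_word_image:
  "vectorspace.basis (ring_of_type_algebra :: 'k ring) U (word_image scale br1 br2 I f ` L I)"
proof -
  let ?K = "ring_of_type_algebra :: 'k ring"
  let ?\<pi> = "word_image scale br1 br2 I f"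
  interpret U: vectorspace ?K U by (rule vectorspace_U_Lie2)
  have K: "carrier ?K = UNIV" "\<zero>\<^bsub>?K\<^esub> = 0" by (simp_all add: ring_of_type_algebra_def)
  have comb_keys: "Poly_Mapping.keys (\<Sum>w\<in>T. poly_scale (c w) (word w)) \<subseteq> T" for c :: "_ \<Rightarrow> 'k" and T
    by (rule keys_span_words) (auto intro!: poly.span_sum poly.span_scale intro: poly.span_base simp del: poly_scale_single)
  have comb: "U.lincomb a (?\<pi> ` T) = coset (\<Sum>w\<in>T. poly_scale (a (?\<pi> w)) (word w))"
    if "finite T" "T \<subseteq> L I" for a T
    using that
  proof (induction T rule: finite_induct)
    case empty
    then show ?case by (simp add: U.lincomb_def U_zero)
  next
    case (insert w T)
    have w: "w \<in> W" and T: "T \<subseteq> W" using insert.prems L_subset_lists by auto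
    have sum: "Poly_Mapping.keys (\<Sum>w\<in>T. poly_scale (a (?\<pi> w)) (word w)) \<subseteq> W"
      using comb_keys T by fast
    \<comment> \<open>Coefficients are attached to cosets, so distinct words of \<open>L\<close>
      must have distinct images.\<close>
    have "?\<pi> w \<notin> ?\<pi> ` T"
      using insert.hyps insert.prems inj_on_word_image by (auto dest: inj_onD)
    moreover have "?\<pi> v \<in> carrier U" if "v \<in> W" for v
      using U_coset(1)[of "word v"] that by (simp add: word_image_eq)
    then have "?\<pi> ` T \<subseteq> carrier U" "?\<pi> w \<in> carrier U" using w T by auto
    ultimately have "U.lincomb a (?\<pi> ` T \<union> {?\<pi> w}) = a (?\<pi> w) \<odot>\<^bsub>U\<^esub> ?\<pi> w \<oplus>\<^bsub>U\<^esub> U.lincomb a (?\<pi> ` T)"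
      using insert.hyps by (intro U.lincomb_insert) (auto simp: K)
    also have "\<dots> = coset (poly_scale (a (?\<pi> w)) (word w) + (\<Sum>w\<in>T. poly_scale (a (?\<pi> w)) (word w)))"
      using insert w sum by (subst (2) word_image_eq) (simp add: U_coset keys_single)
    finally show ?case using insert.hyps by simp
  qed
  have "U.lin_indpt (?\<pi> ` L I)"
  proof
    assume "U.lin_dep (?\<pi> ` L I)"
    then obtain A a v where A: "finite A" "A \<subseteq> ?\<pi> ` L I" "U.lincomb a A = \<zero>\<^bsub>U\<^esub>" "v \<in> A" "a v \<noteq> 0"
      unfolding U.lin_dep_def K by blast
    obtain T where T: "T \<subseteq> L I" "inj_on ?\<pi> T" "A = ?\<pi> ` T"
      using A(2) unfolding subset_image_inj by blast
    have fin: "finite T" using A(1) T(2,3) finite_imageD by blast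
    let ?p = "\<Sum>w\<in>T. poly_scale (a (?\<pi> w)) (word w)"
    have keys: "Poly_Mapping.keys ?p \<subseteq> L I" using comb_keys T(1) by fast
    have keysW: "Poly_Mapping.keys ?p \<subseteq> W" using order_trans[OF keys L_subset_lists] .
    have "coset ?p = coset 0" using A(3) comb[OF fin T(1)] T(3) U_zero by simp
    then have "?p \<in> J" using coset_eq_iff[OF keysW, of 0] by simp
    then have "?p = 0" using independence[OF inj_on_content_L _ keys] by (simp add: ideal_eq)
    obtain w where w: "w \<in> T" "v = ?\<pi> w" using A(4) T(3) by blast
    have "Poly_Mapping.lookup ?p w = (\<Sum>u\<in>T. if u = w then a (?\<pi> u) else 0)"
      unfolding lookup_sum by (rule sum.cong) (auto simp: lookup_single when_def)
    also have "\<dots> = a v" using fin w by simp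
    finally show False using \<open>?p = 0\<close> A(5) by simp
  qed
  moreover have sub: "?\<pi> ` L I \<subseteq> carrier U"
  proof (rule image_subsetI)
    fix w assume "w \<in> L I"
    then have "w \<in> W" using L_subset_lists by blast
    then show "?\<pi> w \<in> carrier U" using U_coset(1)[of "word w"] by (simp add: word_image_eq)
  qed
  moreover have "U.span (?\<pi> ` L I) = carrier U"
  proof
    show "U.span (?\<pi> ` L I) \<subseteq> carrier U" using sub by (rule U.span_is_subset2)
    show "carrier U \<subseteq> U.span (?\<pi> ` L I)"
    proof
      fix x assume "x \<in> carrier U"
      then obtain p where p: "Poly_Mapping.keys p \<subseteq> W" "x = coset p" using carrier_U by blast
      have "word ` W \<subseteq> poly.span (all_translates \<union> word ` L I)"
        using spanning[OF L_subset_lists exists_L_word_with_content] by blast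
      then have "p \<in> poly.span (all_translates \<union> word ` L I)"
        using poly_in_span_words[OF p(1)] poly.span_minimal by blast
      \<comment> \<open>The summand in the ideal vanishes in the quotient; \<open>q\<close> supplies
        the coefficients.\<close>
      then obtain j q where jq: "p = j + q" "j \<in> J" "q \<in> poly.span (word ` L I)"
        unfolding poly.span_Un ideal_eq by blast
      define T where "T = Poly_Mapping.keys q"
      have T: "T \<subseteq> L I" "finite T" using keys_span_words[OF jq(3)] by (simp_all add: T_def)
      have "Poly_Mapping.keys q \<subseteq> W" using T(1) L_subset_lists unfolding T_def by blast
      then have "x = coset q" using p jq(1,2) coset_eq_iff[of p q] by simp
      define a where "a y = Poly_Mapping.lookup q (the_inv_into (L I) ?\<pi> y)" for y
      have "a (?\<pi> w) = Poly_Mapping.lookup q w" if "w \<in> T" for w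
        using that T(1) by (simp add: a_def the_inv_into_f_f[OF inj_on_word_image] subset_iff)
      then have "(\<Sum>w\<in>T. poly_scale (a (?\<pi> w)) (word w)) = q"
        using poly_decompose[of q] by (simp add: T_def)
      then have "x = U.lincomb a (?\<pi> ` T)" using comb[OF T(2,1)] \<open>x = coset q\<close> by simp
      then show "x \<in> U.span (?\<pi> ` L I)"
        unfolding U.span_def using T by (auto simp: K)
    qed
  qed
  ultimately show ?thesis unfolding U.basis_def by blast
qed

end

theorem theorem1:
  fixes scale :: "'k::field \<Rightarrow> 'g::ab_group_add \<Rightarrow> 'g"
    and br1 br2 :: "'g \<Rightarrow> 'g \<Rightarrow> 'g"
    and I :: "'i::wellorder set"
    and f :: "'i \<Rightarrow> 'g"
  assumes "lie2_algebra scale br1 br2"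
    and "vector_space.basis_family scale I f"
  shows "inj_on (word_image scale br1 br2 I f) (L I) \<and>
    vectorspace.basis (ring_of_type_algebra :: 'k ring) (U_Lie2 scale br1 br2 I f)
      (word_image scale br1 br2 I f ` L I)"
proof -
  interpret lie2_basis scale br1 br2 I f
    using assms by (intro lie2_basis.intro lie2_basis_axioms.intro)
  show ?thesis using inj_on_word_image basis_word_image by blast
qed

end
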